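(* Let $m\leq n$. Let $\mathbb{R}^n$ and $\mathbb{R}^m$ be equipped with norms (not necessarily Euclidean) and suppose that the norm on $\mathbb{R}^m$ is strictly convex. Let $\mathcal{F}$ be a locally uniformly closed subset of the set of $1$-Lipschitz maps of $\mathbb{R}^n$ to $\mathbb{R}^m$. (a) Suppose that $\mathcal{F}$ has the property that for any absolutely continuous measure $\mu\in\mathcal{W}(\mathbb{R}^n,\mathbb{R}^m)$ and any $\mathcal{F}$-optimal potential $u_0$ of $\mu$ we have $\mu(A)=0$ for any transport set $A$ of $u_0$. Then either $m=1$, or $m>1$ and both of the following hold: (i) $m=n$, any $u\in\mathcal{F}$ is affine, and there exists $u\in\mathcal{F}$ that is an isometry of $\mathbb{R}^n$ and of $\mathbb{R}^m$; (ii) for any absolutely continuous $\mu\in\mathcal{W}(\mathbb{R}^n,\mathbb{R}^m)$, any $\mathcal{F}$-optimal potential of $\mu$ is an isometry on a maximal subspace $V\subset\mathbb{R}^n$, so that $$\mu(\{x\in\mathbb{R}^n\mid Px\in A\})=0\quad\text{for any Borel set }A\subset W,\qquad(\ast)$$ where $P$ denotes a projection onto a complement $W$ of $V$ (along $V$). (b) Suppose that the norms on $\mathbb{R}^n$ and $\mathbb{R}^m$ are Euclidean, and let $\mu\in\mathcal{W}(\mathbb{R}^n,\mathbb{R}^m)$ be absolutely continuous. If any $\mathcal{F}$-optimal potential of $\mu$ is affine and is an isometry on a maximal subspace $V\subset\mathbb{R}^n$ such that $(\ast)$ holds true, then $\mu(A)=0$ for any transport set $A$ of any $\mathcal{F}$-optimal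 potential of $\mu$.
   Context: $\langle\cdot,\cdot\rangle$ is the standard scalar product on $\mathbb{R}^m$ and $\int\langle u,d\mu\rangle=\sum_{i=1}^m\int u_i\,d\mu_i$ for an $\mathbb{R}^m$-valued Borel measure $\mu$; $\|\mu\|$ is its total variation measure. $\mathcal{W}(\mathbb{R}^n,\mathbb{R}^m)$ is the space of all $\mathbb{R}^m$-valued Borel measures $\mu$ on $\mathbb{R}^n$ with $\mu(\mathbb{R}^n)=0$ and $\int \|x-x_0\|\,d\|\mu\|(x)<\infty$ for some $x_0\in\mathbb{R}^n$. Absolutely continuous means absolutely continuous with respect to the Lebesgue measure on $\mathbb{R}^n$. "Locally uniformly closed" means closed under locally uniform convergence; "$1$-Lipschitz" is with respect to the given norms. A map $u_0\in\mathcal{F}$ is an $\mathcal{F}$-optimal potential of $\mu\in \mathcal{W}(\mathbb{R}^n,\mathbb{R}^m)$ if $\int_{\mathbb{R}^n}\langle u_0,d\mu\rangle=\sup\{\int_{\mathbb{R}^n}\langle u,d\mu\rangle\mid u\in\mathcal{F}\}$. A leaf of a $1$-Lipschitz map $u\colon\mathbb{R}^n\to\mathbb{R}^m$ is a set $\mathcal{S}\subset\mathbb{R}^n$, maximal with respect to inclusion, such that $u|_{\mathcal{S}}$ is an isometry, i.e. $\|u(x)-u(y)\|=\|x-y\|$ for all $x,y\in\mathcal{S}$. A transport set of $u$ is a Borel set $A\subset\mathbb{R}^n$ such that if $x\in A$ belongs to a unique leaf of $u$, then every $y\in\mathbb{R}^n$ with $\|u(y)-u(x)\|=\|y-x\|$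 belongs to $A$. A subspace $V$ is maximal if it is maximal, with respect to inclusion, among linear subspaces on which the map is an isometry; $V=\{0\}$ is allowed.
   Formalization: Part (a) additionally assumes that every absolutely continuous measure in W(R^n,R^m) has at least one F-optimal potential; without this (a) is false, e.g. for empty F with m>1, and also for some nonempty locally uniformly closed F. *)

theory Defs
  imports "HOL-Analysis.Analysis"
begin

section \<open>Norms\<close>

text \<open>The spaces carry arbitrary norms, passed as functions; the norm of the type class only
  provides the topology and the Borel sets, which are the same for all norms.\<close>

definition is_norm :: "('a::real_vector \<Rightarrow> real) \<Rightarrow> bool" where
  "is_norm p \<longleftrightarrow>
     (\<forall>x. p x = 0 \<longrightarrow> x = 0) \<and>
     (\<forall>c x. p (c *\<^sub>R x) = \<bar>c\<bar> * p x) \<and>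
     (\<forall>x y. p (x + y) \<le> p x + p y)"

definition strictly_convex_norm :: "('a::real_vector \<Rightarrow> real) \<Rightarrow> bool" where
  "strictly_convex_norm p \<longleftrightarrow>
     (\<forall>x y t. p x = 1 \<and> p y = 1 \<and> x \<noteq> y \<and> 0 < t \<and> t < 1 \<longrightarrow>
        p ((1 - t) *\<^sub>R x + t *\<^sub>R y) < 1)"

text \<open>Induced by some inner product, not necessarily the standard one.\<close>

definition euclidean_norm :: "('a::real_vector \<Rightarrow> real) \<Rightarrow> bool" where
  "euclidean_norm p \<longleftrightarrow>
     (\<exists>B. bilinear B \<and> (\<forall>x y. B x y = B y x) \<and> (\<forall>x. x \<noteq> 0 \<longrightarrow> B x x > 0) \<and>
          (\<forall>x. p x = sqrt (B x x)))"

section \<open>Maps between normed spaces\<close>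

definition one_lipschitz ::
    "('a::real_vector \<Rightarrow> real) \<Rightarrow> ('b::real_vector \<Rightarrow> real) \<Rightarrow> ('a \<Rightarrow> 'b) \<Rightarrow> bool" where
  "one_lipschitz p q u \<longleftrightarrow> (\<forall>x y. q (u x - u y) \<le> p (x - y))"

definition isometric_on ::
    "('a::real_vector \<Rightarrow> real) \<Rightarrow> ('b::real_vector \<Rightarrow> real) \<Rightarrow> ('a \<Rightarrow> 'b) \<Rightarrow> 'a set \<Rightarrow> bool" where
  "isometric_on p q u S \<longleftrightarrow> (\<forall>x\<in>S. \<forall>y\<in>S. q (u x - u y) = p (x - y))"

definition affine_map :: "('a::real_vector \<Rightarrow> 'b::real_vector) \<Rightarrow> bool" where
  "affine_map u \<longleftrightarrow> (\<exists>L b. linear L \<and> u = (\<lambda>x. L x + b))"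

text \<open>On the locally compact spaces considered here, locally uniform convergence is uniform
  convergence on compact sets; as this topology is metrizable, sequences suffice.\<close>

definition locally_uniformly_closed ::
    "('a::topological_space \<Rightarrow> 'b::metric_space) set \<Rightarrow> bool" where
  "locally_uniformly_closed F \<longleftrightarrow>
     (\<forall>f u. (\<forall>k::nat. f k \<in> F) \<and> (\<forall>K. compact K \<longrightarrow> uniform_limit K f u sequentially)
        \<longrightarrow> u \<in> F)"

definition leaf ::
    "('a::real_vector \<Rightarrow> real) \<Rightarrow> ('b::real_vector \<Rightarrow> real) \<Rightarrow> ('a \<Rightarrow> 'b) \<Rightarrow> 'a set \<Rightarrow> bool" where
  "leaf p q u S \<longleftrightarrow>
     isometric_on p q u S \<and> (\<forall>T. S \<subseteq> T \<and> isometric_on p q u T \<longrightarrow> T = S)"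

definition transport_set ::
    "('a::real_normed_vector \<Rightarrow> real) \<Rightarrow> ('b::real_vector \<Rightarrow> real) \<Rightarrow> ('a \<Rightarrow> 'b) \<Rightarrow> 'a set \<Rightarrow> bool"
  where
  "transport_set p q u A \<longleftrightarrow>
     A \<in> sets borel \<and>
     (\<forall>x\<in>A. (\<exists>!S. leaf p q u S \<and> x \<in> S) \<longrightarrow> (\<forall>y. q (u y - u x) = p (y - x) \<longrightarrow> y \<in> A))"

definition maximal_isometry_subspace ::
    "('a::real_vector \<Rightarrow> real) \<Rightarrow> ('b::real_vector \<Rightarrow> real) \<Rightarrow> ('a \<Rightarrow> 'b) \<Rightarrow> 'a set \<Rightarrow> bool" where
  "maximal_isometry_subspace p q u V \<longleftrightarrow>
     subspace V \<and> isometric_on p q u V \<and>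
     (\<forall>V'. subspace V' \<and> V \<subseteq> V' \<and> isometric_on p q u V' \<longrightarrow> V' = V)"

section \<open>Vector measures\<close>

text \<open>A vector measure is a countably additive set function on the Borel sets; its values on
  other sets are irrelevant.\<close>

definition vector_measure ::
    "('a::topological_space set \<Rightarrow> 'b::real_normed_vector) \<Rightarrow> bool" where
  "vector_measure \<mu> \<longleftrightarrow>
     \<mu> {} = 0 \<and>
     (\<forall>A::nat \<Rightarrow> 'a set. range A \<subseteq> sets borel \<and> disjoint_family A \<longrightarrow>
        (\<lambda>i. \<mu> (A i)) sums \<mu> (\<Union>i. A i))"

text \<open>Total variation with respect to the norm \<open>q\<close> on the values: supremum over countable Borel
  partitions.\<close>

definition total_variation ::
    "('b \<Rightarrow> real) \<Rightarrow> ('a::topological_space set \<Rightarrow> 'b) \<Rightarrow> 'a measure" where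
  "total_variation q \<mu> = measure_of UNIV (sets borel)
     (\<lambda>A. SUP B\<in>{B::nat \<Rightarrow> 'a set. range B \<subseteq> sets borel \<and> disjoint_family B \<and> (\<Union>i. B i) = A}.
        (\<Sum>i. ennreal (q (\<mu> (B i)))))"

text \<open>Upper variation of a signed measure, i.e. the positive part of its Jordan decomposition;
  \<open>ennreal\<close> maps negative numbers to \<open>0\<close>. The negative part is the upper variation of \<open>- \<nu>\<close>.\<close>

definition upper_variation :: "('a::topological_space set \<Rightarrow> real) \<Rightarrow> 'a measure" where
  "upper_variation \<nu> = measure_of UNIV (sets borel)
     (\<lambda>A. SUP B\<in>{B \<in> sets borel. B \<subseteq> A}. ennreal (\<nu> B))"

definition signed_integral ::
    "('a::topological_space set \<Rightarrow> real) \<Rightarrow> ('a \<Rightarrow> real) \<Rightarrow> real" where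
  "signed_integral \<nu> f =
     (\<integral>x. f x \<partial>upper_variation \<nu>) - (\<integral>x. f x \<partial>upper_variation (\<lambda>A. - \<nu> A))"

definition vector_integral ::
    "('a::topological_space \<Rightarrow> real ^ 'm) \<Rightarrow> ('a set \<Rightarrow> real ^ 'm) \<Rightarrow> real" where
  "vector_integral u \<mu> = (\<Sum>i\<in>UNIV. signed_integral (\<lambda>A. \<mu> A $ i) (\<lambda>x. u x $ i))"

definition abs_continuous :: "('a::euclidean_space set \<Rightarrow> 'b::zero) \<Rightarrow> bool" where
  "abs_continuous \<mu> \<longleftrightarrow> (\<forall>A\<in>null_sets lborel. \<mu> A = 0)"

definition W_space ::
    "(real ^ 'n \<Rightarrow> real) \<Rightarrow> (real ^ 'm \<Rightarrow> real) \<Rightarrow> ((real ^ 'n) set \<Rightarrow> real ^ 'm) set" where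
  "W_space p q = {\<mu>. vector_measure \<mu> \<and> \<mu> UNIV = 0 \<and>
     (\<exists>x0. (\<integral>\<^sup>+ x. ennreal (p (x - x0)) \<partial>total_variation q \<mu>) < \<infinity>)}"

definition optimal_potential ::
    "(real ^ 'n \<Rightarrow> real ^ 'm) set \<Rightarrow> ((real ^ 'n) set \<Rightarrow> real ^ 'm) \<Rightarrow> (real ^ 'n \<Rightarrow> real ^ 'm) \<Rightarrow> bool"
  where
  "optimal_potential F \<mu> u0 \<longleftrightarrow>
     u0 \<in> F \<and> ereal (vector_integral u0 \<mu>) = (SUP u\<in>F. ereal (vector_integral u \<mu>))"

definition projection_along ::
    "('a::real_vector \<Rightarrow> 'a) \<Rightarrow> 'a set \<Rightarrow> 'a set \<Rightarrow> bool" where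
  "projection_along P W V \<longleftrightarrow>
     linear P \<and> range P = W \<and> (\<forall>x\<in>W. P x = x) \<and> {x. P x = 0} = V"

text \<open>The complement \<open>W\<close> of \<open>V\<close> is arbitrary; for a subspace \<open>V\<close> and a vector measure \<open>\<mu>\<close> the
  condition does not depend on its choice.\<close>

definition vanishes_on_cylinders ::
    "('a::real_normed_vector set \<Rightarrow> 'b::zero) \<Rightarrow> 'a set \<Rightarrow> bool" where
  "vanishes_on_cylinders \<mu> V \<longleftrightarrow>
     (\<forall>P W. projection_along P W V \<longrightarrow> (\<forall>A\<in>sets borel. A \<subseteq> W \<longrightarrow> \<mu> {x. P x \<in> A} = 0))"

end

theory Submission
  imports Defs
begin

text \<open>Call two points linked by a potential \<open>u\<close> if \<open>u\<close> preserves their distance. The points linked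
  to some point of a compact set form a closed set, and this saturation is a transport set: a point
  with a unique leaf is linked exactly to the points of that leaf, and these are linked to each
  other (\<open>transport_set_saturation\<close>). The hypothesis of part (a) therefore supplies, for every
  balanced integrable density with a finite first moment, an optimal potential for which every
  saturation has measure zero. Two choices of the density give the structure of the class.

  Potentials are affine (\<open>affine_if_transport_sets_null\<close>). Suppose that a potential is bent at a
  point \<open>c\<close> of a segment from \<open>a\<close> to \<open>b\<close>. Place constant vectors on small balls around the three
  points such that the integral almost only measures the bend, but such that, up to a factor, the
  only linear relation between the three vectors is that their sum is zero; dimension at least two
  leaves room for this. For an optimal potential, the saturation of the ball around \<open>a\<close> then meets
  all three balls in the same volume, so some point near \<open>a\<close> is linked to some point near \<open>b\<close>. By
  strict convexity the optimal potential is almost affine on the three points and its integral is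
  almost zero, whereas the bent potential has an integral bounded away from zero.

  Some potential is an isometry (\<open>isometry_if_transport_sets_null\<close>). Multiply a fixed vector by a
  scalar density that is balanced, negative everywhere outside the unit ball and constant inside.
  The saturation of the ball can have measure zero only if it is the whole space. The linear part of
  the optimal potential then preserves norms up to a bounded error, hence exactly. It is injective,
  which forces equal dimensions.

  For an affine potential with linear part \<open>L\<close>, the points linked to \<open>x\<close> are \<open>x + K\<close> with the cone
  \<open>K = {w. q (L w) = p w}\<close>, and \<open>x\<close> has a unique leaf iff \<open>K\<close> is a subspace. If \<open>K\<close> is a subspace,
  it is the maximal subspace of isometry, and the transport sets are the Borel cylinders along \<open>K\<close>.
  If it is not, every Borel set is a transport set, and the measure vanishes altogether. This is (ii)
  (\<open>vanishes_on_maximal_isometry_subspace\<close>). For Euclidean norms \<open>K\<close> is the zero set of a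
  nonnegative quadratic form, hence always a subspace, which gives part (b)
  (\<open>transport_set_null_of_vanishes_on_cylinders\<close>).\<close>

section \<open>Norms on Euclidean spaces\<close>

lemma is_norm_scaleR: "is_norm r \<Longrightarrow> r (c *\<^sub>R x) = \<bar>c\<bar> * r x"
  and is_norm_triangle: "is_norm r \<Longrightarrow> r (x + y) \<le> r x + r y"
  and is_norm_eq_0D: "is_norm r \<Longrightarrow> r x = 0 \<Longrightarrow> x = 0"
  by (simp_all add: is_norm_def)

lemma is_norm_0: "is_norm r \<Longrightarrow> r 0 = 0"
  using is_norm_scaleR[of r 0 0] by simp

lemma is_norm_minus: "is_norm r \<Longrightarrow> r (- x) = r x"
  using is_norm_scaleR[of r "-1" x] by simp

lemma is_norm_diff_commute: "is_norm r \<Longrightarrow> r (x - y) = r (y - x)"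
  using is_norm_minus[of r "x - y"] by simp

lemma is_norm_nonneg: "is_norm r \<Longrightarrow> 0 \<le> r x"
  using is_norm_triangle[of r x "- x"] by (simp add: is_norm_0 is_norm_minus)

lemma is_norm_pos: "is_norm r \<Longrightarrow> x \<noteq> 0 \<Longrightarrow> 0 < r x"
  using is_norm_nonneg[of r x] is_norm_eq_0D[of r x] by fastforce

lemma is_norm_diff_le: "is_norm r \<Longrightarrow> \<bar>r x - r y\<bar> \<le> r (x - y)"
  using is_norm_triangle[of r "x - y" y] is_norm_triangle[of r "y - x" x]
  by (simp add: is_norm_diff_commute[of r y x])

lemma is_norm_sum:
  assumes "is_norm r" "finite A"
  shows "r (sum f A) \<le> (\<Sum>i\<in>A. r (f i))"
  using assms(2)
proof (induction A rule: finite_induct)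
  case (insert a A)
  then show ?case
    using is_norm_triangle[OF assms(1), of "f a" "sum f A"] by simp
qed (simp add: is_norm_0[OF assms(1)])

lemma is_norm_upper_bound:
  fixes r :: "'a::euclidean_space \<Rightarrow> real"
  assumes "is_norm r"
  obtains C where "C > 0" "\<And>x. r x \<le> C * norm x"
proof
  let ?C = "1 + (\<Sum>b\<in>Basis. r b)"
  show "?C > 0"
    using is_norm_nonneg[OF assms] by (simp add: add_pos_nonneg sum_nonneg)
  fix x :: 'a
  have "r x = r (\<Sum>b\<in>Basis. (x \<bullet> b) *\<^sub>R b)"
    by (simp add: euclidean_representation)
  also have "\<dots> \<le> (\<Sum>b\<in>Basis. \<bar>x \<bullet> b\<bar> * r b)"
    using is_norm_sum[OF assms, of Basis "\<lambda>b. (x \<bullet> b) *\<^sub>R b"]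
    by (simp add: is_norm_scaleR[OF assms])
  also have "\<dots> \<le> (\<Sum>b\<in>Basis. norm x * r b)"
    by (intro sum_mono mult_right_mono is_norm_nonneg[OF assms] Basis_le_norm)
  also have "\<dots> \<le> ?C * norm x"
    by (simp add: sum_distrib_left algebra_simps)
  finally show "r x \<le> ?C * norm x" .
qed

lemma continuous_on_is_norm:
  fixes r :: "'a::euclidean_space \<Rightarrow> real"
  assumes "is_norm r"
  shows "continuous_on S r"
proof -
  obtain C where C: "C > 0" "\<And>x. r x \<le> C * norm x"
    using is_norm_upper_bound[OF assms] by blast
  have "C-lipschitz_on S r"
    using C order_trans[OF is_norm_diff_le[OF assms] C(2)]
    by (intro lipschitz_onI) (auto simp: dist_norm)
  then show ?thesis
    by (rule lipschitz_on_continuous_on)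
qed

lemma continuous_on_is_norm_compose:
  fixes r :: "'a::euclidean_space \<Rightarrow> real"
  shows "is_norm r \<Longrightarrow> continuous_on S f \<Longrightarrow> continuous_on S (\<lambda>x. r (f x))"
  using continuous_on_compose2[OF continuous_on_is_norm[of r UNIV], of S f] by simp

lemma is_norm_lower_bound:
  fixes r :: "'a::euclidean_space \<Rightarrow> real"
  assumes "is_norm r"
  obtains c where "c > 0" "\<And>x. norm x \<le> c * r x"
proof -
  have "compact (sphere (0::'a) 1)" "sphere (0::'a) 1 \<noteq> {}"
    by auto
  from continuous_attains_inf[OF this continuous_on_is_norm[OF assms]]
  obtain z where z: "z \<in> sphere 0 1" "\<And>y. y \<in> sphere 0 1 \<Longrightarrow> r z \<le> r y"
    by blast
  have pos: "r z > 0"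
    using z(1) by (intro is_norm_pos[OF assms]) auto
  have "norm x \<le> inverse (r z) * r x" for x
  proof (cases "x = 0")
    case False
    then have "r z \<le> r ((1 / norm x) *\<^sub>R x)"
      by (intro z(2)) auto
    then show ?thesis
      using False pos by (simp add: is_norm_scaleR[OF assms] field_simps)
  qed (simp add: is_norm_0[OF assms])
  with pos show ?thesis
    by (intro that[of "inverse (r z)"]) auto
qed

lemma one_lipschitz_norm_bound:
  fixes p :: "'a::euclidean_space \<Rightarrow> real" and q :: "'b::euclidean_space \<Rightarrow> real"
  assumes "is_norm p" "is_norm q"
  obtains C where "C > 0" "\<And>u x y. one_lipschitz p q u \<Longrightarrow> norm (u x - u y) \<le> C * norm (x - y)"
proof -
  obtain A where A: "A > 0" "\<And>x. p x \<le> A * norm x"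
    using is_norm_upper_bound[OF assms(1)] by blast
  obtain B where B: "B > 0" "\<And>x. norm x \<le> B * q x"
    using is_norm_lower_bound[OF assms(2)] by blast
  have "norm (u x - u y) \<le> B * A * norm (x - y)" if "one_lipschitz p q u" for u x y
  proof -
    have "norm (u x - u y) \<le> B * q (u x - u y)"
      by (rule B(2))
    also have "\<dots> \<le> B * (A * norm (x - y))"
      using that B(1) A(2)[of "x - y"] unfolding one_lipschitz_def
      by (intro mult_left_mono) (auto intro: order_trans)
    finally show ?thesis by (simp add: mult.assoc)
  qed
  with A(1) B(1) show ?thesis
    by (intro that[of "B * A"]) auto
qed

lemma one_lipschitz_continuous_on:
  fixes p :: "'a::euclidean_space \<Rightarrow> real" and q :: "'b::euclidean_space \<Rightarrow> real"
  assumes "is_norm p" "is_norm q" "one_lipschitz p q u"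
  shows "continuous_on S u"
proof -
  obtain C where "C > 0" "\<And>x y. norm (u x - u y) \<le> C * norm (x - y)"
    using one_lipschitz_norm_bound[OF assms(1,2)] assms(3) by metis
  then have "C-lipschitz_on S u"
    by (intro lipschitz_onI) (auto simp: dist_norm)
  then show ?thesis
    by (rule lipschitz_on_continuous_on)
qed

section \<open>Strict convexity\<close>

text \<open>Equality in the triangle inequality forces the two unit vectors to agree, since otherwise the unit
  vector in the direction of the sum would be a proper convex combination of them, of norm less
  than one.\<close>

lemma strictly_convex_norm_collinear:
  assumes r: "is_norm r" "strictly_convex_norm r"
    and le: "r x \<le> s" "r y \<le> t" and pos: "0 < s" "0 < t" and eq: "s + t \<le> r (x + y)"
  shows "t *\<^sub>R x = s *\<^sub>R y"
proof (rule ccontr)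
  assume neq: "t *\<^sub>R x \<noteq> s *\<^sub>R y"
  have xy: "r x = s" "r y = t"
    using is_norm_triangle[OF r(1), of x y] le eq by auto
  let ?x = "(1 / s) *\<^sub>R x" and ?y = "(1 / t) *\<^sub>R y" and ?c = "t / (s + t)"
  have "?x \<noteq> ?y"
  proof
    assume "?x = ?y"
    then have "(s * t) *\<^sub>R ?x = (s * t) *\<^sub>R ?y" by simp
    with pos neq show False by simp
  qed
  moreover have "r ?x = 1" "r ?y = 1"
    using xy pos by (simp_all add: is_norm_scaleR[OF r(1)])
  moreover have "0 < ?c" "?c < 1"
    using pos by auto
  ultimately have "r ((1 - ?c) *\<^sub>R ?x + ?c *\<^sub>R ?y) < 1"
    using r(2) unfolding strictly_convex_norm_def by blast
  also have "(1 - ?c) *\<^sub>R ?x + ?c *\<^sub>R ?y = (1 / (s + t)) *\<^sub>R (x + y)"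
  proof -
    have "(1 - ?c) * (1 / s) = 1 / (s + t)" "?c * (1 / t) = 1 / (s + t)"
      using pos by (simp_all add: field_simps)
    then show ?thesis
      by (simp add: scaleR_add_right)
  qed
  finally have "r (x + y) / (s + t) < 1"
    using pos by (simp only: is_norm_scaleR[OF r(1)]) simp
  then show False
    using eq pos by simp
qed

text \<open>The uniform version of the equality case: the pairs that violate the conclusion form a compact
  set, on which the continuous function \<open>r (x + y)\<close> attains a maximum, and this maximum is less
  than \<open>s + t\<close>.\<close>

lemma strictly_convex_norm_almost_collinear:
  fixes r :: "'a::euclidean_space \<Rightarrow> real"
  assumes r: "is_norm r" "strictly_convex_norm r" and pos: "0 < s" "0 < t" "0 < \<eta>"
  obtains \<kappa> where "\<kappa> > 0"
    "\<And>x y. r x \<le> s \<Longrightarrow> r y \<le> t \<Longrightarrow> s + t - \<kappa> \<le> r (x + y) \<Longrightarrow> norm (t *\<^sub>R x - s *\<^sub>R y) < \<eta>"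
proof -
  define K where "K = {z::'a \<times> 'a. r (fst z) \<le> s \<and> r (snd z) \<le> t \<and>
    \<eta> \<le> norm (t *\<^sub>R fst z - s *\<^sub>R snd z)}"
  obtain c where c: "c > 0" "\<And>x. norm x \<le> c * r x"
    using is_norm_lower_bound[OF r(1)] by blast
  have bound: "norm x \<le> c * d" if "r x \<le> d" for x d
    using c(2)[of x] mult_left_mono[OF that, of c] c(1) by linarith
  have "K \<subseteq> cball 0 (c * s) \<times> cball 0 (c * t)"
    using bound by (simp add: K_def subset_iff)
  moreover have "closed K"
    unfolding K_def
    by (intro closed_Collect_conj closed_Collect_le continuous_intros continuous_on_is_norm_compose[OF r(1)])
  ultimately have cpt: "compact K"
    by (metis bounded_Times bounded_cball bounded_subset compact_eq_bounded_closed)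
  show ?thesis
  proof (cases "K = {}")
    case True
    show ?thesis
    proof (rule that[of 1])
      fix x y assume "r x \<le> s" "r y \<le> t"
      moreover have "(x, y) \<notin> K"
        using True by simp
      ultimately show "norm (t *\<^sub>R x - s *\<^sub>R y) < \<eta>"
        by (simp add: K_def)
    qed simp
  next
    case False
    have "continuous_on K (\<lambda>z. r (fst z + snd z))"
      by (intro continuous_intros continuous_on_is_norm_compose[OF r(1)])
    from continuous_attains_sup[OF cpt False this]
    obtain x y where xy: "(x, y) \<in> K" "\<And>x' y'. (x', y') \<in> K \<Longrightarrow> r (x' + y') \<le> r (x + y)"
      by force
    have "r (x + y) < s + t"
    proof (rule ccontr)
      assume "\<not> ?thesis"
      then have "t *\<^sub>R x = s *\<^sub>R y"
        using xy(1) pos by (intro strictly_convex_norm_collinear[OF r]) (auto simp: K_def)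
      then show False
        using xy(1) pos by (simp add: K_def)
    qed
    show ?thesis
    proof (rule that[of "(s + t - r (x + y)) / 2"])
      show "0 < (s + t - r (x + y)) / 2"
        using \<open>r (x + y) < s + t\<close> by simp
      fix x' y' assume "r x' \<le> s" "r y' \<le> t" "s + t - (s + t - r (x + y)) / 2 \<le> r (x' + y')"
      moreover have "(x', y') \<notin> K"
      proof (intro notI)
        assume "(x', y') \<in> K"
        from xy(2)[OF this] show False
          using calculation(3) \<open>r (x + y) < s + t\<close> by argo
      qed
      ultimately show "norm (t *\<^sub>R x' - s *\<^sub>R y') < \<eta>"
        by (simp add: K_def)
    qed
  qed
qed

section \<open>Vector measures with a density\<close>

definition density_measure :: "('a::euclidean_space \<Rightarrow> 'b::euclidean_space) \<Rightarrow> 'a set \<Rightarrow> 'b" where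
  "density_measure f A = (LINT x:A|lborel. f x)"

lemma vector_measure_density_measure:
  assumes "integrable lborel f"
  shows "vector_measure (density_measure f)"
  unfolding vector_measure_def
proof (intro conjI allI impI)
  show "density_measure f {} = 0"
    by (simp add: density_measure_def set_lebesgue_integral_def)
  fix A :: "nat \<Rightarrow> 'a set"
  assume A: "range A \<subseteq> sets borel \<and> disjoint_family A"
  have int: "set_integrable lborel B f" if "B \<in> sets borel" for B
    using integrable_mult_indicator[of B lborel f] that assms by (simp add: set_integrable_def)
  have "(\<lambda>i. density_measure f (\<Union>j<i. A j)) \<longlonglongrightarrow> density_measure f (\<Union>i. A i)"
  proof -
    have "(\<lambda>i. (LINT x:(\<Union>j<i. A j)|lborel. f x)) \<longlonglongrightarrow> (LINT x:(\<Union>i. \<Union>j<i. A j)|lborel. f x)"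
    proof (rule set_integral_cont_up)
      show "(\<Union>j<i. A j) \<in> sets lborel" for i
        using A by (auto intro!: sets.finite_UN)
      show "incseq (\<lambda>i. \<Union>j<i. A j)"
        unfolding incseq_def by (intro allI impI UN_mono) auto
      show "set_integrable lborel (\<Union>i. \<Union>j<i. A j) f"
        using A by (intro int) (auto intro!: sets.countable_UN sets.finite_UN)
    qed
    also have "(\<Union>i. \<Union>j<i. A j) = (\<Union>i. A i)"
      by auto
    finally show ?thesis
      by (simp add: density_measure_def)
  qed
  moreover have "density_measure f (\<Union>j<i. A j) = (\<Sum>j<i. density_measure f (A j))" for i
    unfolding density_measure_def
    using A by (intro set_integral_finite_Union int)
      (auto simp: disjoint_family_on_def)
  ultimately show "(\<lambda>i. density_measure f (A i)) sums density_measure f (\<Union>i. A i)"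
    by (simp add: sums_def)
qed

lemma abs_continuous_density_measure: "abs_continuous (density_measure f)"
  unfolding abs_continuous_def density_measure_def set_lebesgue_integral_def
proof
  fix A :: "'a set"
  assume "A \<in> null_sets lborel"
  then have "AE x in lborel. indicator A x *\<^sub>R f x = 0"
    by (rule eventually_mono[OF AE_not_in]) auto
  then show "(LINT x|lborel. indicat_real A x *\<^sub>R f x) = 0"
    by (rule integral_eq_zero_AE)
qed

text \<open>An upper bound suffices to get a finite first moment. It spares the proof that the supremum in
  \<open>total_variation\<close> is countably additive: if it were not, \<open>measure_of\<close> would yield the zero
  measure, for which the bound holds as well.\<close>

lemma total_variation_density_measure_le:
  fixes f :: "'a::euclidean_space \<Rightarrow> 'b::euclidean_space"
  assumes f: "integrable lborel f" and C: "0 \<le> C" "\<And>x. q x \<le> C * norm x"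
  shows "total_variation q (density_measure f) \<le> density lborel (\<lambda>x. ennreal (C * norm (f x)))"
    (is "?T \<le> ?D")
proof -
  have [measurable]: "f \<in> borel_measurable borel"
    using f by auto
  let ?S = "\<lambda>A. SUP B\<in>{B::nat \<Rightarrow> 'a set. range B \<subseteq> sets borel \<and> disjoint_family B \<and> (\<Union>i. B i) = A}.
        (\<Sum>i. ennreal (q (density_measure f (B i))))"
  have piece: "ennreal (q (density_measure f B)) \<le> emeasure ?D B" if B: "B \<in> sets borel" for B
  proof -
    have int: "set_integrable lborel B f"
      using integrable_mult_indicator[of B lborel f] B f by (simp add: set_integrable_def)
    then have "q (density_measure f B) \<le> C * (LINT x:B|lborel. norm (f x))"
      using C set_integral_norm_bound[OF int]
      by (auto simp: density_measure_def intro!: order_trans[OF C(2)] mult_left_mono)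
    also have "\<dots> = (LINT x|lborel. indicator B x * (C * norm (f x)))"
      by (simp add: set_lebesgue_integral_def mult.left_commute)
    finally have "ennreal (q (density_measure f B)) \<le> ennreal \<dots>"
      by (rule ennreal_leI)
    also have "\<dots> = (\<integral>\<^sup>+x. ennreal (indicator B x * (C * norm (f x))) \<partial>lborel)"
    proof (rule nn_integral_eq_integral[symmetric])
      show "integrable lborel (\<lambda>x. indicat_real B x * (C * norm (f x)))"
        using integrable_mult_indicator[of B lborel "\<lambda>x. C * norm (f x)"] B f by simp
    qed (use C in auto)
    also have "\<dots> = emeasure ?D B"
      using B by (auto simp: emeasure_density intro!: nn_integral_cong split: split_indicator)
    finally show ?thesis .
  qed
  have sup: "?S A \<le> emeasure ?D A" for A
  proof (rule SUP_least)
    fix B :: "nat \<Rightarrow> 'a set"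
    assume "B \<in> {B. range B \<subseteq> sets borel \<and> disjoint_family B \<and> (\<Union>i. B i) = A}"
    then have B: "range B \<subseteq> sets borel" "disjoint_family B" "(\<Union>i. B i) = A"
      by auto
    have "(\<Sum>i. ennreal (q (density_measure f (B i)))) \<le> (\<Sum>i. emeasure ?D (B i))"
      using B by (intro suminf_le piece) auto
    also have "\<dots> = emeasure ?D A"
      using B by (subst suminf_emeasure) auto
    finally show "(\<Sum>i. ennreal (q (density_measure f (B i)))) \<le> emeasure ?D A" .
  qed
  have "sets ?T = sets borel"
    unfolding total_variation_def using sets.sigma_sets_eq[of "borel :: 'a measure"]
    by (simp add: sets_measure_of_conv)
  moreover have "emeasure ?T A \<le> emeasure ?D A" for A
    unfolding total_variation_def emeasure_measure_of_conv using sup by simp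
  ultimately show ?thesis
    by (subst le_measure) (auto simp: le_fun_def)
qed

lemma density_measure_in_W_space:
  fixes f :: "real ^ 'n \<Rightarrow> real ^ 'm"
  assumes p: "is_norm p" and q: "is_norm q"
    and f: "integrable lborel f" "integrable lborel (\<lambda>x. norm x * norm (f x))"
    and zero: "integral\<^sup>L lborel f = 0"
  shows "density_measure f \<in> W_space p q"
proof -
  have [measurable]: "f \<in> borel_measurable borel"
    using f by auto
  have [measurable]: "p \<in> borel_measurable borel"
    by (intro borel_measurable_continuous_onI continuous_on_is_norm[OF p])
  obtain A where A: "A > 0" "\<And>x. p x \<le> A * norm x"
    using is_norm_upper_bound[OF p] by blast
  obtain C where C: "C > 0" "\<And>x. q x \<le> C * norm x"
    using is_norm_upper_bound[OF q] by blast
  let ?T = "total_variation q (density_measure f)"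
  let ?D = "density lborel (\<lambda>x. ennreal (C * norm (f x)))"
  have "?T \<le> ?D"
    using C by (intro total_variation_density_measure_le f) auto
  moreover have "sets ?T = sets ?D"
    unfolding total_variation_def using sets.sigma_sets_eq[of "borel :: (real^'n) measure"]
    by (simp add: sets_measure_of_conv)
  ultimately have "(\<integral>\<^sup>+ x. ennreal (p (x - 0)) \<partial>?T) \<le> (\<integral>\<^sup>+ x. ennreal (p (x - 0)) \<partial>?D)"
    by (intro nn_integral_mono_measure)
  also have "\<dots> = (\<integral>\<^sup>+ x. ennreal (C * norm (f x)) * ennreal (p x) \<partial>lborel)"
    by (subst nn_integral_density) auto
  also have "\<dots> \<le> (\<integral>\<^sup>+ x. ennreal (C * A * (norm x * norm (f x))) \<partial>lborel)"
  proof (rule nn_integral_mono)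
    fix x :: "real ^ 'n"
    have "C * norm (f x) * p x \<le> C * norm (f x) * (A * norm x)"
      using C(1) A(2)[of x] by (intro mult_left_mono) auto
    then show "ennreal (C * norm (f x)) * ennreal (p x) \<le> ennreal (C * A * (norm x * norm (f x)))"
      using C(1) is_norm_nonneg[OF p]
      by (subst ennreal_mult[symmetric]) (auto intro!: ennreal_leI simp: ac_simps)
  qed
  also have "\<dots> = ennreal (LINT x|lborel. C * A * (norm x * norm (f x)))"
    using C(1) A(1) f by (intro nn_integral_eq_integral) auto
  also have "\<dots> < \<infinity>"
    by simp
  finally have "(\<integral>\<^sup>+ x. ennreal (p (x - 0)) \<partial>?T) < \<infinity>" .
  moreover have "density_measure f UNIV = 0"
    using zero by (simp add: density_measure_def set_lebesgue_integral_def)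
  ultimately show ?thesis
    unfolding W_space_def using vector_measure_density_measure[OF f(1)] by blast
qed

text \<open>The supremum is attained at the part of the set where the density is positive. On the right-hand
  side, \<open>ennreal\<close> truncates negative values to zero.\<close>

lemma upper_variation_density:
  fixes g :: "'a::euclidean_space \<Rightarrow> real"
  assumes g: "integrable lborel g"
  shows "upper_variation (\<lambda>A. LINT x:A|lborel. g x) = density lborel (\<lambda>x. ennreal (g x))"
proof -
  have [measurable]: "g \<in> borel_measurable borel"
    using g by auto
  let ?D = "density lborel (\<lambda>x. ennreal (g x))"
  let ?S = "\<lambda>A. SUP B\<in>{B \<in> sets borel. B \<subseteq> A}. ennreal (LINT x:B|lborel. g x)"
  have eq: "?S A = emeasure ?D A" if A: "A \<in> sets borel" for A
  proof (rule antisym)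
    have int: "integrable lborel (\<lambda>x. indicator B x * max 0 (g x))" if "B \<in> sets borel" for B
      using integrable_mult_indicator[of B lborel "\<lambda>x. max 0 (g x)"] that g by simp
    have D: "emeasure ?D B = ennreal (LINT x|lborel. indicator B x * max 0 (g x))"
      if B: "B \<in> sets borel" for B
    proof -
      have "ennreal (LINT x|lborel. indicator B x * max 0 (g x)) =
          (\<integral>\<^sup>+x. ennreal (indicator B x * max 0 (g x)) \<partial>lborel)"
        using int[OF B] by (intro nn_integral_eq_integral[symmetric]) auto
      also have "\<dots> = emeasure ?D B"
        using B by (auto simp: emeasure_density ennreal_neg max_def intro!: nn_integral_cong
            split: split_indicator)
      finally show ?thesis by simp
    qed
    show "?S A \<le> emeasure ?D A"
    proof (rule SUP_least)
      fix B assume "B \<in> {B \<in> sets borel. B \<subseteq> A}"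
      then have B: "B \<in> sets borel" "B \<subseteq> A" by auto
      have "(LINT x:B|lborel. g x) \<le> (LINT x|lborel. indicator B x * max 0 (g x))"
        unfolding set_lebesgue_integral_def
        using integrable_mult_indicator[of B lborel g] B g int[OF B(1)]
        by (intro integral_mono) (auto split: split_indicator)
      then have "ennreal (LINT x:B|lborel. g x) \<le> emeasure ?D B"
        unfolding D[OF B(1)] by (rule ennreal_leI)
      also have "\<dots> \<le> emeasure ?D A"
        using A B by (intro emeasure_mono) auto
      finally show "ennreal (LINT x:B|lborel. g x) \<le> emeasure ?D A" .
    qed
    let ?B = "A \<inter> {x. 0 < g x}"
    have B: "?B \<in> sets borel"
      using A by measurable
    have "emeasure ?D A = ennreal (LINT x:?B|lborel. g x)"
      unfolding D[OF A] set_lebesgue_integral_def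
      by (auto intro!: arg_cong[where f = ennreal] Bochner_Integration.integral_cong
          split: split_indicator)
    also have "\<dots> \<le> ?S A"
      using B by (intro SUP_upper) auto
    finally show "emeasure ?D A \<le> ?S A" .
  qed
  have "upper_variation (\<lambda>A. LINT x:A|lborel. g x) = measure_of UNIV (sets borel) (emeasure ?D)"
    unfolding upper_variation_def
    using eq sets.sigma_sets_eq[of "borel :: 'a measure"] by (intro measure_of_eq) auto
  also have "\<dots> = ?D"
    using measure_of_of_measure[of ?D] by simp
  finally show ?thesis .
qed

lemma signed_integral_density:
  fixes g h :: "'a::euclidean_space \<Rightarrow> real"
  assumes g: "integrable lborel g" and h: "h \<in> borel_measurable borel"
    and gh: "integrable lborel (\<lambda>x. g x * h x)"
  shows "signed_integral (\<lambda>A. LINT x:A|lborel. g x) h = (LINT x|lborel. g x * h x)"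
proof -
  have [measurable]: "g \<in> borel_measurable borel" "h \<in> borel_measurable borel"
    using g h by auto
  have pos: "integral\<^sup>L (density lborel (\<lambda>x. ennreal (k x))) h = (LINT x|lborel. max 0 (k x) * h x)"
    if [measurable]: "k \<in> borel_measurable borel" for k
  proof -
    have "density lborel (\<lambda>x. ennreal (k x)) = density lborel (\<lambda>x. ennreal (max 0 (k x)))"
      by (intro density_cong) (auto simp: max_def ennreal_neg)
    then show ?thesis
      by (simp add: integral_density)
  qed
  have int: "integrable lborel (\<lambda>x. max 0 (c * g x) * h x)" if "\<bar>c\<bar> = 1" for c :: real
  proof (rule Bochner_Integration.integrable_bound[OF gh])
    have "norm (max 0 (c * g x) * h x) \<le> norm (g x * h x)" for x
      using that by (auto simp: abs_mult abs_if max_def intro!: mult_right_mono split: if_splits)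
    then show "AE x in lborel. norm (max 0 (c * g x) * h x) \<le> norm (g x * h x)"
      by simp
  qed auto
  have minus: "(\<lambda>A. - (LINT x:A|lborel. g x)) = (\<lambda>A. LINT x:A|lborel. - g x)"
    by (simp add: set_lebesgue_integral_def)
  have "signed_integral (\<lambda>A. LINT x:A|lborel. g x) h =
      (LINT x|lborel. max 0 (g x) * h x) - (LINT x|lborel. max 0 (- g x) * h x)"
    unfolding signed_integral_def minus using g
    by (simp add: upper_variation_density pos)
  also have "\<dots> = (LINT x|lborel. max 0 (g x) * h x - max 0 (- g x) * h x)"
    using int[of 1] int[of "-1"] by (intro Bochner_Integration.integral_diff[symmetric]) auto
  also have "\<dots> = (LINT x|lborel. g x * h x)"
    by (intro Bochner_Integration.integral_cong) (auto simp: max_def)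
  finally show ?thesis .
qed

lemma vector_integral_density_measure:
  fixes f :: "'a::euclidean_space \<Rightarrow> real ^ 'm" and u :: "'a \<Rightarrow> real ^ 'm"
  assumes f: "integrable lborel f" and u: "u \<in> borel_measurable borel"
    and fu: "integrable lborel (\<lambda>x. norm (u x) * norm (f x))"
  shows "vector_integral u (density_measure f) = (LINT x|lborel. u x \<bullet> f x)"
proof -
  have [measurable]: "f \<in> borel_measurable borel" "u \<in> borel_measurable borel"
    using f u by auto
  have nth: "integrable lborel (\<lambda>x. f x $ i)" for i
    using integrable_bounded_linear[OF bounded_linear_vec_nth f] .
  have [measurable]: "(\<lambda>x. u x $ i) \<in> borel_measurable borel" for i
    by (rule borel_measurable_continuous_on[of "\<lambda>v. v $ i"]) (auto intro!: continuous_intros)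
  have prod: "integrable lborel (\<lambda>x. f x $ i * u x $ i)" for i
  proof (rule Bochner_Integration.integrable_bound[OF fu])
    have "norm (f x $ i * u x $ i) \<le> norm (norm (u x) * norm (f x))" for x
      using mult_mono[OF component_le_norm_cart[of "f x" i] component_le_norm_cart[of "u x" i]]
      by (simp add: abs_mult mult.commute)
    then show "AE x in lborel. norm (f x $ i * u x $ i) \<le> norm (norm (u x) * norm (f x))"
      by simp
  qed (use nth[of i] in measurable)
  have comp: "density_measure f A $ i = (LINT x:A|lborel. f x $ i)" if "A \<in> sets borel" for A i
  proof -
    have "integrable lborel (\<lambda>x. indicat_real A x *\<^sub>R f x)"
      using that f by (intro integrable_mult_indicator) auto
    from integral_bounded_linear[OF bounded_linear_vec_nth[of i] this]
    show ?thesis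
      by (simp add: density_measure_def set_lebesgue_integral_def)
  qed
  have cong: "signed_integral (\<lambda>A. density_measure f A $ i) h =
      signed_integral (\<lambda>A. LINT x:A|lborel. f x $ i) h" for h i
  proof -
    have "upper_variation (\<lambda>A. c * density_measure f A $ i) =
        upper_variation (\<lambda>A. c * (LINT x:A|lborel. f x $ i))" for c
      unfolding upper_variation_def using sets.sigma_sets_eq[of "borel :: 'a measure"]
      by (intro measure_of_eq SUP_cong) (auto simp: comp)
    from this[of 1] this[of "-1"] show ?thesis
      by (simp add: signed_integral_def)
  qed
  have "vector_integral u (density_measure f) = (\<Sum>i\<in>UNIV. LINT x|lborel. f x $ i * u x $ i)"
    unfolding vector_integral_def cong using nth prod by (simp add: signed_integral_density)
  also have "\<dots> = (LINT x|lborel. (\<Sum>i\<in>UNIV. f x $ i * u x $ i))"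
    using prod by (intro Bochner_Integration.integral_sum[symmetric])
  also have "\<dots> = (LINT x|lborel. u x \<bullet> f x)"
    by (simp add: inner_vec_def mult.commute)
  finally show ?thesis .
qed

section \<open>Leaves and transport sets\<close>

text \<open>A union of a chain of sets of isometry is a set of isometry, because the condition concerns
  only two points at a time; so Zorn's lemma applies.\<close>

lemma isometric_on_subset_leaf:
  assumes "isometric_on p q u S"
  obtains T where "S \<subseteq> T" "leaf p q u T"
proof -
  let ?\<A> = "{T. S \<subseteq> T \<and> isometric_on p q u T}"
  have "\<exists>M\<in>?\<A>. \<forall>X\<in>?\<A>. M \<subseteq> X \<longrightarrow> X = M"
  proof (rule subset_Zorn_nonempty)
    fix \<C> assume \<C>: "\<C> \<noteq> {}" "subset.chain ?\<A> \<C>"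
    have "isometric_on p q u (\<Union>\<C>)"
      unfolding isometric_on_def
    proof (intro ballI)
      fix x y assume "x \<in> \<Union>\<C>" "y \<in> \<Union>\<C>"
      then obtain X where "X \<in> \<C>" "x \<in> X" "y \<in> X"
        using \<C>(2) unfolding subset_chain_def by blast
      then show "q (u x - u y) = p (x - y)"
        using \<C>(2) unfolding subset_chain_def isometric_on_def by blast
    qed
    then show "\<Union>\<C> \<in> ?\<A>"
      using \<C> unfolding subset_chain_def by blast
  qed (use assms in auto)
  then obtain M where M: "S \<subseteq> M" "isometric_on p q u M"
    "\<And>X. S \<subseteq> X \<Longrightarrow> isometric_on p q u X \<Longrightarrow> M \<subseteq> X \<Longrightarrow> X = M"
    by auto
  show ?thesis
  proof (rule that[OF M(1)])
    show "leaf p q u M"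
      unfolding leaf_def using M(2) M(3)[OF order_trans[OF M(1)]] by blast
  qed
qed

lemma isometric_on_pair:
  assumes "is_norm p" "is_norm q" "q (u y - u x) = p (y - x)"
  shows "isometric_on p q u {x, y}"
  using assms(3) is_norm_diff_commute[OF assms(1), of x y] is_norm_0[OF assms(1)]
    is_norm_diff_commute[OF assms(2), of "u x" "u y"] is_norm_0[OF assms(2)]
  by (simp add: isometric_on_def)

text \<open>Every point at preserved distance from \<open>x\<close> shares a leaf with \<open>x\<close>, so the union of the leaves
  through \<open>x\<close> is the set on the right. This criterion replaces leaves by pairwise conditions in
  all that follows.\<close>

lemma unique_leaf_iff:
  assumes p: "is_norm p" and q: "is_norm q"
  shows "(\<exists>!S. leaf p q u S \<and> x \<in> S) \<longleftrightarrow>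
    isometric_on p q u {y. q (u y - u x) = p (y - x)}" (is "?lhs \<longleftrightarrow> isometric_on p q u ?N")
proof
  assume ?lhs
  then obtain S where S: "leaf p q u S" and uniq: "\<And>T. leaf p q u T \<Longrightarrow> x \<in> T \<Longrightarrow> T = S"
    by blast
  have "?N \<subseteq> S"
  proof
    fix y assume "y \<in> ?N"
    then have "isometric_on p q u {x, y}"
      by (intro isometric_on_pair[OF p q]) simp
    then obtain T where "{x, y} \<subseteq> T" "leaf p q u T"
      by (rule isometric_on_subset_leaf)
    with uniq[of T] show "y \<in> S" by simp
  qed
  with S show "isometric_on p q u ?N"
    unfolding leaf_def isometric_on_def by blast
next
  assume N: "isometric_on p q u ?N"
  have x: "x \<in> ?N"
    by (simp add: is_norm_0[OF p] is_norm_0[OF q])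
  have sub: "T \<subseteq> ?N" if "isometric_on p q u T" "x \<in> T" for T
    using that unfolding isometric_on_def by blast
  show ?lhs
  proof (rule ex1I[of _ ?N])
    show "leaf p q u ?N \<and> x \<in> ?N"
      unfolding leaf_def using N x sub by blast
    show "S = ?N" if "leaf p q u S \<and> x \<in> S" for S
      using that N sub[of S] unfolding leaf_def by blast
  qed
qed

definition saturation ::
    "('a::real_vector \<Rightarrow> real) \<Rightarrow> ('b::real_vector \<Rightarrow> real) \<Rightarrow> ('a \<Rightarrow> 'b) \<Rightarrow> 'a set \<Rightarrow> 'a set" where
  "saturation p q u C = {y. \<exists>x\<in>C. q (u y - u x) = p (y - x)}"

lemma subset_saturation: "is_norm p \<Longrightarrow> is_norm q \<Longrightarrow> C \<subseteq> saturation p q u C"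
  using is_norm_0[of p] is_norm_0[of q] by (auto simp: saturation_def intro!: bexI)

lemma closed_saturation:
  fixes p :: "'a::euclidean_space \<Rightarrow> real" and q :: "'b::euclidean_space \<Rightarrow> real"
  assumes "is_norm p" "is_norm q" "one_lipschitz p q u" "compact C"
  shows "closed (saturation p q u C)"
proof -
  have u: "continuous_on S (\<lambda>z. u (f z))" if "continuous_on S f" for S and f :: "'a \<times> 'a \<Rightarrow> 'a"
    using continuous_on_compose2[OF one_lipschitz_continuous_on[OF assms(1-3), of UNIV] that]
    by simp
  have "closed {z. q (u (snd z) - u (fst z)) = p (snd z - fst z)}"
    by (intro closed_Collect_eq continuous_intros u continuous_on_is_norm_compose[OF assms(1)]
        continuous_on_is_norm_compose[OF assms(2)])
  from closed_compact_projection[OF assms(4) this] show ?thesis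
    by (simp add: saturation_def Bex_def)
qed

text \<open>If \<open>x\<close> is linked to \<open>c \<in> C\<close> and has a unique leaf, then \<open>c\<close> lies in that leaf, and every
  point linked to \<open>x\<close> lies in it too and is therefore linked to \<open>c\<close>. Compactness makes the
  saturation closed, in particular a Borel set.\<close>

lemma transport_set_saturation:
  fixes p :: "'a::euclidean_space \<Rightarrow> real" and q :: "'b::euclidean_space \<Rightarrow> real"
  assumes p: "is_norm p" and q: "is_norm q" and u: "one_lipschitz p q u" and C: "compact C"
  shows "transport_set p q u (saturation p q u C)"
  unfolding transport_set_def
proof (intro conjI ballI impI allI)
  show "saturation p q u C \<in> sets borel"
    using closed_saturation[OF assms] by (rule borel_closed)
  fix x y
  assume "x \<in> saturation p q u C"
    and leaf: "\<exists>!S. leaf p q u S \<and> x \<in> S" and y: "q (u y - u x) = p (y - x)"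
  then obtain c where c: "c \<in> C" "q (u x - u c) = p (x - c)"
    by (auto simp: saturation_def)
  have "q (u c - u x) = p (c - x)"
    using c(2) is_norm_diff_commute[OF p, of x c] is_norm_diff_commute[OF q, of "u x" "u c"] by simp
  with leaf y have "q (u y - u c) = p (y - c)"
    unfolding unique_leaf_iff[OF p q] isometric_on_def by blast
  with c(1) show "y \<in> saturation p q u C"
    by (auto simp: saturation_def)
qed

section \<open>Affine potentials\<close>

definition isometry_cone ::
    "('a::real_vector \<Rightarrow> real) \<Rightarrow> ('b::real_vector \<Rightarrow> real) \<Rightarrow> ('a \<Rightarrow> 'b) \<Rightarrow> 'a set" where
  "isometry_cone p q L = {w. q (L w) = p w}"

context
  fixes p :: "'a::euclidean_space \<Rightarrow> real" and q :: "'b::euclidean_space \<Rightarrow> real"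
    and L :: "'a \<Rightarrow> 'b" and b :: 'b and u :: "'a \<Rightarrow> 'b"
  assumes p: "is_norm p" and q: "is_norm q" and L: "linear L" and u: "u = (\<lambda>x. L x + b)"
begin

lemma affine_isometric_pair_iff: "q (u y - u x) = p (y - x) \<longleftrightarrow> y - x \<in> isometry_cone p q L"
  by (simp add: u isometry_cone_def linear_diff[OF L])

lemma zero_in_isometry_cone: "0 \<in> isometry_cone p q L"
  by (simp add: isometry_cone_def linear_0[OF L] is_norm_0[OF p] is_norm_0[OF q])

lemma scaleR_in_isometry_cone:
  "w \<in> isometry_cone p q L \<Longrightarrow> c *\<^sub>R w \<in> isometry_cone p q L"
  by (simp add: isometry_cone_def linear_scale[OF L] is_norm_scaleR[OF p] is_norm_scaleR[OF q])

lemma isometric_on_subspace_iff: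
  assumes "subspace V"
  shows "isometric_on p q u V \<longleftrightarrow> V \<subseteq> isometry_cone p q L"
proof
  assume "isometric_on p q u V"
  then have "w - 0 \<in> isometry_cone p q L" if "w \<in> V" for w
    using that subspace_0[OF assms] affine_isometric_pair_iff[of w 0]
    unfolding isometric_on_def by blast
  then show "V \<subseteq> isometry_cone p q L" by auto
next
  assume "V \<subseteq> isometry_cone p q L"
  then show "isometric_on p q u V"
    using subspace_diff[OF assms] affine_isometric_pair_iff unfolding isometric_on_def by blast
qed

text \<open>The points linked to \<open>x\<close> form the translate \<open>x + K\<close> of the isometry cone, and \<open>x + K\<close> is a set
  of isometry iff \<open>K\<close> is closed under differences. The answer is thus the same for all points.\<close>

lemma unique_leaf_affine_iff: "(\<exists>!S. leaf p q u S \<and> x \<in> S) \<longleftrightarrow> subspace (isometry_cone p q L)"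
proof -
  let ?K = "isometry_cone p q L"
  have "isometric_on p q u {y. y - x \<in> ?K} \<longleftrightarrow> subspace ?K"
  proof
    assume iso: "isometric_on p q u {y. y - x \<in> ?K}"
    have diff: "w - z \<in> ?K" if "w \<in> ?K" "z \<in> ?K" for w z
    proof -
      have "q (u (x + w) - u (x + z)) = p ((x + w) - (x + z))"
        using iso that unfolding isometric_on_def by force
      then show ?thesis
        unfolding affine_isometric_pair_iff by simp
    qed
    show "subspace ?K"
    proof (rule subspaceI)
      fix w z assume "w \<in> ?K" "z \<in> ?K"
      then show "w + z \<in> ?K"
        using diff[of w "- z"] scaleR_in_isometry_cone[of z "-1"] by simp
    qed (auto intro: zero_in_isometry_cone scaleR_in_isometry_cone)
  next
    assume sub: "subspace ?K"
    show "isometric_on p q u {y. y - x \<in> ?K}"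
      unfolding isometric_on_def affine_isometric_pair_iff
    proof (intro ballI)
      fix y z assume "y \<in> {y. y - x \<in> ?K}" "z \<in> {y. y - x \<in> ?K}"
      then show "y - z \<in> ?K"
        using subspace_diff[OF sub, of "y - x" "z - x"] by simp
    qed
  qed
  then show ?thesis
    unfolding unique_leaf_iff[OF p q] affine_isometric_pair_iff .
qed

lemma transport_set_affine_iff:
  "transport_set p q u A \<longleftrightarrow> A \<in> sets borel \<and>
    (subspace (isometry_cone p q L) \<longrightarrow> (\<forall>x\<in>A. \<forall>y. y - x \<in> isometry_cone p q L \<longrightarrow> y \<in> A))"
  unfolding transport_set_def unique_leaf_affine_iff affine_isometric_pair_iff by auto

lemma maximal_isometry_subspace_eq_cone:
  assumes "subspace (isometry_cone p q L)"
  shows "maximal_isometry_subspace p q u V \<longleftrightarrow> V = isometry_cone p q L"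
proof
  have K: "isometric_on p q u (isometry_cone p q L)"
    using isometric_on_subspace_iff[OF assms] by simp
  show "V = isometry_cone p q L" if "maximal_isometry_subspace p q u V"
    using that isometric_on_subspace_iff[of V] assms K
    unfolding maximal_isometry_subspace_def by metis
  show "maximal_isometry_subspace p q u V" if "V = isometry_cone p q L"
    unfolding maximal_isometry_subspace_def that
    using assms K isometric_on_subspace_iff by (meson subset_antisym)
qed

lemma maximal_isometry_subspace_exists: "\<exists>V. maximal_isometry_subspace p q u V"
proof -
  let ?K = "isometry_cone p q L"
  let ?P = "\<lambda>V. subspace V \<and> V \<subseteq> ?K"
  have "?P {0}"
    using zero_in_isometry_cone by simp
  moreover have "\<forall>V. ?P V \<longrightarrow> dim V < Suc DIM('a)"
    using dim_subset_UNIV[where 'a = 'a] by (simp add: less_Suc_eq_le)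
  ultimately obtain V where V: "?P V" "\<And>V'. ?P V' \<Longrightarrow> dim V' \<le> dim V"
    using ex_has_greatest_nat[of ?P "{0}" dim "Suc DIM('a)"] by blast
  have "V' = V" if "subspace V'" "V \<subseteq> V'" "isometric_on p q u V'" for V'
    using that V subspace_dim_equal[of V V'] isometric_on_subspace_iff by blast
  then show ?thesis
    using V(1) isometric_on_subspace_iff unfolding maximal_isometry_subspace_def by blast
qed

text \<open>If the isometry cone is a subspace, it is the kernel \<open>V\<close> of the projection, so cylinders are unions
  of leaves. Otherwise no point has a unique leaf and all Borel sets are transport sets.\<close>

lemma vanishes_on_maximal_isometry_subspace:
  assumes "\<And>A. transport_set p q u A \<Longrightarrow> \<mu> A = 0"
  shows "\<exists>V. maximal_isometry_subspace p q u V \<and> vanishes_on_cylinders \<mu> V"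
proof -
  obtain V where V: "maximal_isometry_subspace p q u V"
    using maximal_isometry_subspace_exists by blast
  have "\<mu> {x. P x \<in> A} = 0"
    if P: "projection_along P W V" and A: "A \<in> sets borel" for P W A
  proof -
    have lin: "linear P" and ker: "{x. P x = 0} = V"
      using P by (auto simp: projection_along_def)
    have "P -` A \<inter> space borel \<in> sets borel"
      using A lin
      by (intro measurable_sets[OF borel_measurable_continuous_onI]) (auto intro: linear_continuous_on linear_conv_bounded_linear[THEN iffD1])
    then have "{x. P x \<in> A} \<in> sets borel"
      by (simp add: vimage_def)
    moreover have "P y \<in> A"
      if "subspace (isometry_cone p q L)" "P x \<in> A" "y - x \<in> isometry_cone p q L" for x y
    proof -
      have "y - x \<in> V"
        using that V maximal_isometry_subspace_eq_cone by blast
      then have "P (y - x) = 0"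
        using ker by blast
      then show ?thesis
        using that(2) linear_diff[OF lin, of y x] by simp
    qed
    ultimately show ?thesis
      by (intro assms) (auto simp: transport_set_affine_iff)
  qed
  with V show ?thesis
    by (auto simp: vanishes_on_cylinders_def)
qed

text \<open>The cone is the zero set of \<open>Q w = (p w)\<^sup>2 - (q (L w))\<^sup>2\<close>, a quadratic form that is nonnegative
  because \<open>L\<close> is a contraction. By the parallelogram identity, \<open>Q (w + z) + Q (w - z) = 0\<close> if \<open>w\<close>
  and \<open>z\<close> are zeros.\<close>

lemma subspace_isometry_cone_euclidean:
  assumes e: "euclidean_norm p" "euclidean_norm q" and lip: "one_lipschitz p q u"
  shows "subspace (isometry_cone p q L)"
proof -
  obtain B where B: "bilinear B" "\<And>x. p x = sqrt (B x x)" "\<And>x y. B x y = B y x"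
    "\<And>x. x \<noteq> 0 \<Longrightarrow> B x x > 0"
    using e(1) unfolding euclidean_norm_def by blast
  obtain D where D: "bilinear D" "\<And>x. q x = sqrt (D x x)" "\<And>x y. D x y = D y x"
    "\<And>x. x \<noteq> 0 \<Longrightarrow> D x x > 0"
    using e(2) unfolding euclidean_norm_def by blast
  define Q where "Q w = B w w - D (L w) (L w)" for w
  have cone: "w \<in> isometry_cone p q L \<longleftrightarrow> Q w = 0" for w
    by (auto simp: isometry_cone_def B(2) D(2) Q_def)
  have Q_nonneg: "0 \<le> Q w" for w
  proof -
    have "q (L w) \<le> p w"
      using lip[unfolded one_lipschitz_def, rule_format, of w 0] by (simp add: u linear_0[OF L])
    then show ?thesis
      by (simp add: B(2) D(2) Q_def)
  qed
  have par: "Q (w + z) + Q (w - z) = 2 * Q w + 2 * Q z" for w z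
    by (simp add: Q_def linear_add[OF L] linear_diff[OF L] bilinear_ladd[OF B(1)] bilinear_radd[OF B(1)]
        bilinear_lsub[OF B(1)] bilinear_rsub[OF B(1)] bilinear_ladd[OF D(1)] bilinear_radd[OF D(1)]
        bilinear_lsub[OF D(1)] bilinear_rsub[OF D(1)])
  show ?thesis
  proof (rule subspaceI)
    fix w z assume "w \<in> isometry_cone p q L" "z \<in> isometry_cone p q L"
    then show "w + z \<in> isometry_cone p q L"
      using par[of w z] Q_nonneg[of "w + z"] Q_nonneg[of "w - z"] by (simp add: cone)
  qed (auto intro: zero_in_isometry_cone scaleR_in_isometry_cone)
qed

end

text \<open>The orthogonal projection onto the orthogonal complement of \<open>V\<close>.\<close>

lemma projection_along_exists:
  fixes V :: "'a::euclidean_space set"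
  assumes "subspace V"
  obtains P W where "projection_along P W V"
proof -
  obtain B where B: "B \<subseteq> V" "pairwise orthogonal B" "\<And>x. x \<in> B \<Longrightarrow> norm x = 1"
    "independent B" "span B = V"
    using orthonormal_basis_subspace[OF assms] by metis
  have fin: "finite B"
    using B(4) by (rule independent_imp_finite)
  define P where "P x = x - (\<Sum>b\<in>B. (x \<bullet> b) *\<^sub>R b)" for x
  have lin: "linear P"
    unfolding P_def
    by (rule linearI) (simp_all add: inner_add_left scaleR_add_left sum.distrib scaleR_sum_right algebra_simps)
  have orth: "P x \<bullet> b = 0" if "b \<in> B" for x b
  proof -
    have "(\<Sum>c\<in>B. (x \<bullet> c) * (c \<bullet> b)) = (\<Sum>c\<in>B. if c = b then x \<bullet> b else 0)"
      using B(2,3) that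
      by (intro sum.cong) (auto simp: pairwise_def orthogonal_def norm_eq_1)
    then show ?thesis
      using that fin by (simp add: P_def inner_diff_left inner_sum_left)
  qed
  have PP: "P (P x) = P x" for x
    using orth by (subst P_def) simp
  have "P x = 0 \<longleftrightarrow> x \<in> V" for x
  proof
    assume "P x = 0"
    then have "x = (\<Sum>b\<in>B. (x \<bullet> b) *\<^sub>R b)"
      by (simp add: P_def)
    also have "\<dots> \<in> V"
      using B(1) by (intro subspace_sum[OF assms] subspace_scale[OF assms]) auto
    finally show "x \<in> V" .
  next
    assume "x \<in> V"
    then have "P x \<in> span B"
      unfolding P_def B(5) using B(1)
      by (intro subspace_diff[OF assms] subspace_sum[OF assms] subspace_scale[OF assms]) auto
    then have "orthogonal (P x) (P x)"
      by (rule orthogonal_to_span) (simp add: orth orthogonal_def)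
    then show "P x = 0"
      by (simp add: orthogonal_def)
  qed
  then show ?thesis
    using lin PP by (intro that[of P "range P"]) (auto simp: projection_along_def)
qed

text \<open>Every point has a unique leaf, a translate of \<open>V\<close>; hence a transport set is a cylinder over its
  intersection with a complement of \<open>V\<close>.\<close>

lemma transport_set_null_of_vanishes_on_cylinders:
  fixes p :: "'a::euclidean_space \<Rightarrow> real" and q :: "'b::euclidean_space \<Rightarrow> real"
  assumes p: "is_norm p" "euclidean_norm p" and q: "is_norm q" "euclidean_norm q"
    and u: "one_lipschitz p q u" "affine_map u"
    and V: "maximal_isometry_subspace p q u V" "vanishes_on_cylinders \<mu> V"
    and A: "transport_set p q u A"
  shows "\<mu> A = 0"
proof -
  obtain L b where L: "linear L" and ueq: "u = (\<lambda>x. L x + b)"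
    using u(2) unfolding affine_map_def by blast
  note affine = p(1) q(1) L ueq
  have sub: "subspace (isometry_cone p q L)"
    using subspace_isometry_cone_euclidean[OF affine p(2) q(2) u(1)] .
  with V(1) have Veq: "V = isometry_cone p q L"
    using maximal_isometry_subspace_eq_cone[OF affine] by blast
  have A': "A \<in> sets borel" and sat: "\<And>x y. x \<in> A \<Longrightarrow> y - x \<in> V \<Longrightarrow> y \<in> A"
    using A sub unfolding transport_set_affine_iff[OF affine] Veq by auto
  obtain P W where P: "projection_along P W V"
    using sub unfolding Veq[symmetric] by (rule projection_along_exists)
  have lin: "linear P" and ran: "range P = W" and fixW: "\<forall>x\<in>W. P x = x"
    and ker: "{x. P x = 0} = V"
    using P unfolding projection_along_def by simp_all
  have W: "W = {x. P x = x}"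
  proof (rule set_eqI)
    fix x
    show "x \<in> W \<longleftrightarrow> x \<in> {x. P x = x}"
      using fixW rangeI[of P x] unfolding ran by auto
  qed
  have "continuous_on UNIV P"
    using lin by (simp add: linear_continuous_on linear_conv_bounded_linear)
  then have "closed W"
    unfolding W by (intro closed_Collect_eq continuous_intros)
  then have "A \<inter> W \<in> sets borel"
    using A' by auto
  then have null: "\<mu> {x. P x \<in> A \<inter> W} = 0"
    using V(2) P unfolding vanishes_on_cylinders_def by blast
  have PV: "P x - x \<in> V" "x - P x \<in> V" and PW: "P x \<in> W" for x
  proof -
    show "P x \<in> W"
      using ran by blast
    then have "P (P x) = P x"
      by (simp add: W)
    then show "P x - x \<in> V" "x - P x \<in> V"
      unfolding ker[symmetric] by (simp_all add: linear_diff[OF lin])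
  qed
  have "{x. P x \<in> A \<inter> W} = A"
    using sat PV PW by blast
  with null show ?thesis by simp
qed

section \<open>Measures concentrated on small balls\<close>

definition ball_density ::
    "'i set \<Rightarrow> ('i \<Rightarrow> 'a::euclidean_space) \<Rightarrow> ('i \<Rightarrow> 'b::euclidean_space) \<Rightarrow> real \<Rightarrow> 'a \<Rightarrow> 'b" where
  "ball_density I a v \<epsilon> x = (\<Sum>i\<in>I. indicator (cball (a i) \<epsilon>) x *\<^sub>R v i)"

lemma integrable_ball_density: "integrable lborel (ball_density I a v \<epsilon>)"
  unfolding ball_density_def
  by (intro Bochner_Integration.integrable_sum borel_integrable_compact) auto

lemma integrable_norm_mult_ball_density:
  fixes h :: "'a::euclidean_space \<Rightarrow> 'c::euclidean_space"
  assumes h: "continuous_on UNIV h"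
  shows "integrable lborel (\<lambda>x. norm (h x) * norm (ball_density I a v \<epsilon> x))"
proof (rule Bochner_Integration.integrable_bound)
  show "integrable lborel (\<lambda>x. \<Sum>i\<in>I. indicator (cball (a i) \<epsilon>) x *\<^sub>R (norm (h x) * norm (v i)))"
    using h by (intro Bochner_Integration.integrable_sum borel_integrable_compact)
      (auto intro!: continuous_intros intro: continuous_on_subset)
  have "h \<in> borel_measurable borel"
    using h by (rule borel_measurable_continuous_onI)
  moreover have "ball_density I a v \<epsilon> \<in> borel_measurable borel"
    using integrable_ball_density[of I a v \<epsilon>] by auto
  ultimately show "(\<lambda>x. norm (h x) * norm (ball_density I a v \<epsilon> x)) \<in> borel_measurable lborel"
    by simp
  have "norm (h x) * norm (ball_density I a v \<epsilon> x) \<le>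
      (\<Sum>i\<in>I. indicator (cball (a i) \<epsilon>) x *\<^sub>R (norm (h x) * norm (v i)))" for x
  proof -
    have "norm (ball_density I a v \<epsilon> x) \<le> (\<Sum>i\<in>I. indicator (cball (a i) \<epsilon>) x * norm (v i))"
      unfolding ball_density_def
      by (rule order_trans[OF norm_sum]) (auto intro!: sum_mono split: split_indicator)
    from mult_left_mono[OF this norm_ge_zero[of "h x"]] show ?thesis
      by (simp add: sum_distrib_left mult.left_commute)
  qed
  from order_trans[OF this abs_ge_self] show "AE x in lborel.
      norm (norm (h x) * norm (ball_density I a v \<epsilon> x)) \<le>
      norm (\<Sum>i\<in>I. indicator (cball (a i) \<epsilon>) x *\<^sub>R (norm (h x) * norm (v i)))"
    by simp
qed

lemma density_measure_ball_density:
  assumes A: "A \<in> sets borel"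
  shows "density_measure (ball_density I a v \<epsilon>) A =
    (\<Sum>i\<in>I. measure lborel (A \<inter> cball (a i) \<epsilon>) *\<^sub>R v i)"
proof -
  have fin: "emeasure lborel (A \<inter> cball (a i) \<epsilon>) < \<infinity>" for i
    using emeasure_mono[of "A \<inter> cball (a i) \<epsilon>" "cball (a i) \<epsilon>" lborel] emeasure_lborel_cball_finite[of "a i" \<epsilon>]
    by (auto intro: le_less_trans)
  have int: "integrable lborel (indicat_real (A \<inter> cball (a i) \<epsilon>))" for i
    using A fin[of i] by (intro integrable_real_indicator) auto
  have "density_measure (ball_density I a v \<epsilon>) A =
      (LINT x|lborel. (\<Sum>i\<in>I. indicat_real (A \<inter> cball (a i) \<epsilon>) x *\<^sub>R v i))"
    unfolding density_measure_def set_lebesgue_integral_def ball_density_def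
    by (intro Bochner_Integration.integral_cong) (auto simp: scaleR_sum_right indicator_inter_arith)
  also have "\<dots> = (\<Sum>i\<in>I. (LINT x|lborel. indicat_real (A \<inter> cball (a i) \<epsilon>) x *\<^sub>R v i))"
    by (rule Bochner_Integration.integral_sum) (intro integrable_scaleR_left int)
  also have "\<dots> = (\<Sum>i\<in>I. measure lborel (A \<inter> cball (a i) \<epsilon>) *\<^sub>R v i)"
    using int by simp
  finally show ?thesis .
qed

lemma ball_density_measure_in_W_space:
  fixes a :: "'i \<Rightarrow> real ^ 'n" and v :: "'i \<Rightarrow> real ^ 'm"
  assumes "is_norm p" "is_norm q" "0 \<le> \<epsilon>" "(\<Sum>i\<in>I. v i) = 0"
  shows "density_measure (ball_density I a v \<epsilon>) \<in> W_space p q"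
proof (rule density_measure_in_W_space[OF assms(1,2)])
  show "integrable lborel (ball_density I a v \<epsilon>)"
    by (rule integrable_ball_density)
  show "integrable lborel (\<lambda>x. norm x * norm (ball_density I a v \<epsilon> x))"
    by (rule integrable_norm_mult_ball_density) (intro continuous_intros)
  have "integral\<^sup>L lborel (ball_density I a v \<epsilon>) = density_measure (ball_density I a v \<epsilon>) UNIV"
    by (simp add: density_measure_def set_lebesgue_integral_def)
  also have "\<dots> = (\<Sum>i\<in>I. measure lborel (cball (0 :: real ^ 'n) \<epsilon>) *\<^sub>R v i)"
    using assms(3) by (simp add: density_measure_ball_density content_cball)
  also have "\<dots> = 0"
    using assms(4) by (simp add: scaleR_sum_right[symmetric])
  finally show "integral\<^sup>L lborel (ball_density I a v \<epsilon>) = 0" .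
qed

lemma vector_integral_ball_density:
  fixes a :: "'i \<Rightarrow> 'a::euclidean_space" and v :: "'i \<Rightarrow> real ^ 'm" and u :: "'a \<Rightarrow> real ^ 'm"
  assumes u: "\<And>x y. norm (u x - u y) \<le> C * norm (x - y)" and C: "0 \<le> C" and \<epsilon>: "0 \<le> \<epsilon>"
  shows "\<bar>vector_integral u (density_measure (ball_density I a v \<epsilon>)) -
      measure lborel (cball (0 :: 'a) \<epsilon>) * (\<Sum>i\<in>I. u (a i) \<bullet> v i)\<bar> \<le>
    measure lborel (cball (0 :: 'a) \<epsilon>) * (C * \<epsilon> * (\<Sum>i\<in>I. norm (v i)))"
proof -
  have "C-lipschitz_on UNIV u"
    using u C by (intro lipschitz_onI) (auto simp: dist_norm)
  then have cont: "continuous_on UNIV u"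
    by (rule lipschitz_on_continuous_on)
  let ?\<beta> = "measure lborel (cball (0 :: 'a) \<epsilon>)"
  have ball_volume: "measure lborel (cball x \<epsilon>) = ?\<beta>" for x :: 'a
    using \<epsilon> by (simp add: content_cball)
  have int: "integrable lborel (\<lambda>x. indicat_real (cball c \<epsilon>) x *\<^sub>R g x)"
    if "continuous_on UNIV g" for c and g :: "'a \<Rightarrow> real"
    using that by (intro borel_integrable_compact) (auto intro: continuous_on_subset)
  have const: "(LINT x|lborel. indicat_real (cball c \<epsilon>) x *\<^sub>R d) = ?\<beta> * d" for c :: 'a and d :: real
    using ball_volume[of c] by simp
  have ball: "\<bar>(LINT x|lborel. indicat_real (cball c \<epsilon>) x *\<^sub>R (u x \<bullet> w)) - ?\<beta> * (u c \<bullet> w)\<bar>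
      \<le> ?\<beta> * (C * \<epsilon> * norm w)" for c w
  proof -
    have "(LINT x|lborel. indicat_real (cball c \<epsilon>) x *\<^sub>R (u x \<bullet> w)) - ?\<beta> * (u c \<bullet> w) =
        (LINT x|lborel. indicat_real (cball c \<epsilon>) x *\<^sub>R (u x \<bullet> w) - indicat_real (cball c \<epsilon>) x *\<^sub>R (u c \<bullet> w))"
      unfolding const[of c, symmetric]
      by (intro Bochner_Integration.integral_diff[symmetric] int continuous_intros cont)
    also have "\<bar>\<dots>\<bar> \<le> (LINT x|lborel. indicat_real (cball c \<epsilon>) x *\<^sub>R (C * \<epsilon> * norm w))"
    proof (rule integral_abs_bound_integral)
      fix x
      have "\<bar>u x \<bullet> w - u c \<bullet> w\<bar> \<le> C * \<epsilon> * norm w" if "x \<in> cball c \<epsilon>"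
      proof -
        have "\<bar>u x \<bullet> w - u c \<bullet> w\<bar> \<le> norm (u x - u c) * norm w"
          using Cauchy_Schwarz_ineq2[of "u x - u c" w] by (simp add: inner_diff_left)
        also have "\<dots> \<le> (C * norm (x - c)) * norm w"
          by (intro mult_right_mono u) auto
        also have "\<dots> \<le> (C * \<epsilon>) * norm w"
          using that C by (intro mult_right_mono mult_left_mono) (auto simp: dist_norm norm_minus_commute)
        finally show ?thesis .
      qed
      then show "\<bar>indicat_real (cball c \<epsilon>) x *\<^sub>R (u x \<bullet> w) - indicat_real (cball c \<epsilon>) x *\<^sub>R (u c \<bullet> w)\<bar>
          \<le> indicat_real (cball c \<epsilon>) x *\<^sub>R (C * \<epsilon> * norm w)"
        by (auto split: split_indicator)
    qed (intro Bochner_Integration.integrable_diff int continuous_intros cont)+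
    finally show ?thesis
      unfolding const .
  qed
  have "vector_integral u (density_measure (ball_density I a v \<epsilon>)) =
      (LINT x|lborel. u x \<bullet> ball_density I a v \<epsilon> x)"
    by (intro vector_integral_density_measure integrable_ball_density
        integrable_norm_mult_ball_density borel_measurable_continuous_onI cont)
  also have "\<dots> = (\<Sum>i\<in>I. (LINT x|lborel. indicat_real (cball (a i) \<epsilon>) x *\<^sub>R (u x \<bullet> v i)))"
    unfolding ball_density_def inner_sum_right inner_scaleR_right real_scaleR_def[symmetric]
    by (intro Bochner_Integration.integral_sum int continuous_intros cont)
  finally have "\<bar>vector_integral u (density_measure (ball_density I a v \<epsilon>)) -
      ?\<beta> * (\<Sum>i\<in>I. u (a i) \<bullet> v i)\<bar> = \<bar>\<Sum>i\<in>I.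
        (LINT x|lborel. indicat_real (cball (a i) \<epsilon>) x *\<^sub>R (u x \<bullet> v i)) - ?\<beta> * (u (a i) \<bullet> v i)\<bar>"
    by (simp only: sum_distrib_left sum_subtractf)
  also have "\<dots> \<le> (\<Sum>i\<in>I. ?\<beta> * (C * \<epsilon> * norm (v i)))"
    by (intro order_trans[OF sum_abs] sum_mono ball)
  finally show ?thesis
    by (simp only: sum_distrib_left)
qed

section \<open>Every potential is affine\<close>

text \<open>After subtracting \<open>u 0\<close>, segments from the origin give homogeneity, midpoints give additivity.\<close>

lemma affine_map_if_preserves_segments:
  fixes u :: "'a::real_vector \<Rightarrow> 'b::real_vector"
  assumes seg: "\<And>a b t. 0 < t \<Longrightarrow> t < 1 \<Longrightarrow>
    u ((1 - t) *\<^sub>R a + t *\<^sub>R b) = (1 - t) *\<^sub>R u a + t *\<^sub>R u b"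
  shows "affine_map u"
proof -
  define g where "g x = u x - u 0" for x
  have g0: "g 0 = 0"
    by (simp add: g_def)
  have gseg: "g ((1 - t) *\<^sub>R a + t *\<^sub>R b) = (1 - t) *\<^sub>R g a + t *\<^sub>R g b" if "0 < t" "t < 1" for a b t
    using seg[OF that] by (simp add: g_def algebra_simps)
  have small: "g (t *\<^sub>R x) = t *\<^sub>R g x" if "0 < t" "t < 1" for t x
    using gseg[OF that, of 0 x] g0 by simp
  have pos: "g (t *\<^sub>R x) = t *\<^sub>R g x" if "0 < t" for t x
  proof (cases t "1 :: real" rule: linorder_cases)
    case greater
    then have "g x = (1 / t) *\<^sub>R g (t *\<^sub>R x)"
      using small[of "1 / t" "t *\<^sub>R x"] by simp
    with greater show ?thesis by simp
  qed (use small that in auto)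
  have add: "g (x + y) = g x + g y" for x y
    using gseg[of "1 / 2" x y] pos[of "1 / 2" "x + y"] pos[of 2 "(1 / 2) *\<^sub>R (x + y)"]
    by (simp add: scaleR_add_right[symmetric])
  have minus: "g (- x) = - g x" for x
    using add[of x "- x"] g0 by (simp add: eq_neg_iff_add_eq_0 add.commute)
  have "linear g"
  proof (rule linearI)
    fix c x
    show "g (c *\<^sub>R x) = c *\<^sub>R g x"
      using pos[of c x] pos[of "- c" x] minus[of "c *\<^sub>R x"] g0
      by (cases c "0 :: real" rule: linorder_cases) auto
  qed (rule add)
  moreover have "u = (\<lambda>x. g x + u 0)"
    by (simp add: g_def)
  ultimately show ?thesis
    unfolding affine_map_def by blast
qed

lemma optimal_potential_ge:
  assumes "optimal_potential F \<mu> u0" "u \<in> F"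
  shows "vector_integral u \<mu> \<le> vector_integral u0 \<mu>"
proof -
  have "ereal (vector_integral u \<mu>) \<le> ereal (vector_integral u0 \<mu>)"
    using assms unfolding optimal_potential_def by (auto intro: SUP_upper)
  then show ?thesis by simp
qed

lemma isometric_pair_nearby:
  assumes p: "is_norm p" and q: "is_norm q" and u: "one_lipschitz p q u"
    and xy: "q (u y - u x) = p (y - x)" and near: "p (x - a) \<le> d" "p (y - b) \<le> d"
  shows "p (b - a) - 4 * d \<le> q (u b - u a)"
proof -
  have "p (b - a) \<le> p (b - y) + (p (y - x) + p (x - a))"
    using is_norm_triangle[OF p, of "b - y" "y - a"] is_norm_triangle[OF p, of "y - x" "x - a"] by simp
  moreover have "q (u y - u x) \<le> q (u y - u b) + (q (u b - u a) + q (u a - u x))"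
    using is_norm_triangle[OF q, of "u y - u b" "u b - u x"]
      is_norm_triangle[OF q, of "u b - u a" "u a - u x"] by simp
  moreover have "q (u y - u b) \<le> p (y - b)" "q (u a - u x) \<le> p (a - x)"
    using u by (simp_all add: one_lipschitz_def)
  ultimately show ?thesis
    using near xy is_norm_diff_commute[OF p, of b y] is_norm_diff_commute[OF p, of a x] by linarith
qed

text \<open>The saturation of the ball around \<open>a i\<close> contains that ball. The functional \<open>e\<close> sees only \<open>v i\<close>
  and \<open>v j\<close>, with opposite values, so a null saturation meets the balls around \<open>a i\<close> and \<open>a j\<close> in
  the same volume, which is positive.\<close>

lemma linked_balls:
  fixes p :: "'a::euclidean_space \<Rightarrow> real" and q :: "'b::euclidean_space \<Rightarrow> real"
  assumes p: "is_norm p" and q: "is_norm q" and u: "one_lipschitz p q u"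
    and \<epsilon>: "0 < \<epsilon>" and finite: "finite I" and ij: "i \<in> I" "j \<in> I" "i \<noteq> j"
    and e: "e \<bullet> v i \<noteq> 0" "e \<bullet> v j = - (e \<bullet> v i)" "\<And>k. k \<in> I \<Longrightarrow> k \<noteq> i \<Longrightarrow> k \<noteq> j \<Longrightarrow> e \<bullet> v k = 0"
    and null: "\<And>A. transport_set p q u A \<Longrightarrow> density_measure (ball_density I a v \<epsilon>) A = 0"
  obtains x y where "x \<in> cball (a i) \<epsilon>" "y \<in> cball (a j) \<epsilon>" "q (u y - u x) = p (y - x)"
proof -
  let ?A = "saturation p q u (cball (a i) \<epsilon>)"
  let ?m = "\<lambda>k. measure lborel (?A \<inter> cball (a k) \<epsilon>)"
  have A: "transport_set p q u ?A"
    by (intro transport_set_saturation p q u compact_cball)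
  then have "?A \<in> sets borel"
    by (simp add: transport_set_def)
  from density_measure_ball_density[OF this, of I a v \<epsilon>] null[OF A]
  have "0 = e \<bullet> (\<Sum>k\<in>I. ?m k *\<^sub>R v k)"
    by simp
  also have "\<dots> = (\<Sum>k\<in>I. ?m k * (e \<bullet> v k))"
    by (simp add: inner_sum_right)
  also have "\<dots> = (\<Sum>k\<in>{i, j}. ?m k * (e \<bullet> v k))"
    using finite ij e(3) by (intro sum.mono_neutral_right) auto
  also have "\<dots> = (?m i - ?m j) * (e \<bullet> v i)"
    using ij e(2) by (simp add: algebra_simps)
  finally have "?m i = ?m j"
    using e(1) by simp
  moreover have "?A \<inter> cball (a i) \<epsilon> = cball (a i) \<epsilon>"
    using subset_saturation[OF p q] by blast
  then have "?m i > 0"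
    using \<epsilon> by simp
  ultimately have "?A \<inter> cball (a j) \<epsilon> \<noteq> {}"
    by force
  then show ?thesis
    using that by (auto simp: saturation_def)
qed

text \<open>The vectors below are \<open>w\<close> at \<open>c\<close>, and \<open>- (1 - t) w + \<delta> e\<close> and \<open>- t w - \<delta> e\<close> at the endpoints,
  where \<open>w\<close> is the bend of \<open>u\<close> at \<open>c\<close> and \<open>e\<close> is orthogonal to \<open>w\<close>. In the limit of small balls
  and apart from their volume, the integral of a potential \<open>f\<close> is the inner product of \<open>w\<close> with the
  bend of \<open>f\<close>, plus \<open>\<delta>\<close> times the component of \<open>f a - f b\<close> in the direction \<open>e\<close>. The term in \<open>\<delta>\<close>
  breaks the proportionality of the vectors at \<open>a\<close> and \<open>b\<close>, so that these two balls become linked.\<close>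

lemma affine_if_transport_sets_null:
  fixes p :: "real ^ 'n \<Rightarrow> real" and q :: "real ^ 'm \<Rightarrow> real"
    and F :: "(real ^ 'n \<Rightarrow> real ^ 'm) set"
  assumes m: "CARD('m) > 1"
    and p: "is_norm p" and q: "is_norm q" "strictly_convex_norm q"
    and F: "\<And>u. u \<in> F \<Longrightarrow> one_lipschitz p q u"
    and H: "\<And>\<mu>. \<mu> \<in> W_space p q \<Longrightarrow> abs_continuous \<mu> \<Longrightarrow>
      \<exists>u0. optimal_potential F \<mu> u0 \<and> (\<forall>A. transport_set p q u0 A \<longrightarrow> \<mu> A = 0)"
    and u: "u \<in> F"
  shows "affine_map u"
proof (rule affine_map_if_preserves_segments, rule ccontr)
  fix a b :: "real ^ 'n" and t :: real
  assume t: "0 < t" "t < 1"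
    and neq: "u ((1 - t) *\<^sub>R a + t *\<^sub>R b) \<noteq> (1 - t) *\<^sub>R u a + t *\<^sub>R u b"
  define c where "c = (1 - t) *\<^sub>R a + t *\<^sub>R b"
  define defect where "defect f = f c - ((1 - t) *\<^sub>R f a + t *\<^sub>R f b)" for f :: "real ^ 'n \<Rightarrow> real ^ 'm"
  define w where "w = defect u"
  have w: "w \<noteq> 0"
    using neq by (simp add: w_def defect_def c_def)
  have "b - a \<noteq> 0"
    using neq by (auto simp: scaleR_add_left[symmetric])
  define D where "D = p (b - a)"
  have D: "D > 0"
    unfolding D_def by (intro is_norm_pos[OF p]) fact
  have ca: "c - a = t *\<^sub>R (b - a)" and bc: "b - c = (1 - t) *\<^sub>R (b - a)"
    by (simp_all add: c_def algebra_simps)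
  have "2 \<le> DIM(real ^ 'm)"
    using m by simp
  then obtain e where e: "e \<noteq> 0" "orthogonal w e"
    by (rule orthogonal_to_vector_exists)
  have ew: "e \<bullet> w = 0"
    using e(2) by (simp add: orthogonal_def inner_commute)
  obtain C where C: "C > 0" "\<And>f x y. one_lipschitz p q f \<Longrightarrow> norm (f x - f y) \<le> C * norm (x - y)"
    using one_lipschitz_norm_bound[OF p q(1)] by metis
  obtain P where P: "P > 0" "\<And>x. p x \<le> P * norm x"
    using is_norm_upper_bound[OF p] by metis
  define W where "W = w \<bullet> w"
  have W: "W > 0"
    using w by (simp add: W_def)
  define X where "X = norm e * (C * norm (a - b))"
  have X: "X \<ge> 0"
    using C(1) by (simp add: X_def)
  \<comment> \<open>The constants are chosen so that three errors are at most \<open>W / 4\<close> each: both terms in \<open>\<delta>\<close>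
    together, the bend of the optimal potential (through \<open>\<kappa>\<close>), and both errors of replacing the
    integrals over balls by values at the centres (through \<open>\<epsilon>\<close>). Optimality would make their sum
    at least \<open>W\<close>.\<close>
  define \<delta> where "\<delta> = W / (8 * (X + 1))"
  have \<delta>: "\<delta> > 0" "2 * (\<delta> * X) < W / 4"
    using W X by (simp_all add: \<delta>_def field_simps)
  define v where "v i = (if i = 0 then - (1 - t) *\<^sub>R w + \<delta> *\<^sub>R e
    else if i = 1 then - t *\<^sub>R w - \<delta> *\<^sub>R e else w)" for i :: nat
  define pt where "pt i = (if i = 0 then a else if i = 1 then b else c)" for i :: nat
  define I where "I = {0, 1, 2 :: nat}"
  have v_sum: "(\<Sum>i\<in>I. v i) = 0"
    by (simp add: I_def v_def algebra_simps)
  have pairing: "(\<Sum>i\<in>I. f (pt i) \<bullet> v i) = w \<bullet> defect f + \<delta> * (e \<bullet> (f a - f b))" for f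
    by (simp add: I_def v_def pt_def defect_def inner_diff_right inner_add_right inner_commute[of _ w]
        inner_commute[of _ e] algebra_simps)
  have shift: "\<bar>\<delta> * (e \<bullet> (f a - f b))\<bar> \<le> \<delta> * X" if "one_lipschitz p q f" for f
  proof -
    have "\<bar>e \<bullet> (f a - f b)\<bar> \<le> norm e * norm (f a - f b)"
      by (rule Cauchy_Schwarz_ineq2)
    also have "\<dots> \<le> X"
      unfolding X_def using C(2)[OF that] by (intro mult_left_mono) auto
    finally show ?thesis
      using \<delta>(1) by (simp add: abs_mult)
  qed
  have "0 < t * D" "0 < (1 - t) * D" "0 < D * norm w / 4"
    using t D w by simp_all
  from strictly_convex_norm_almost_collinear[OF q this] obtain \<kappa> where \<kappa>: "\<kappa> > 0"
    "\<And>x y. q x \<le> t * D \<Longrightarrow> q y \<le> (1 - t) * D \<Longrightarrow> t * D + (1 - t) * D - \<kappa> \<le> q (x + y) \<Longrightarrow>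
      norm (((1 - t) * D) *\<^sub>R x - (t * D) *\<^sub>R y) < D * norm w / 4"
    by metis
  define S where "S = C * (\<Sum>i\<in>I. norm (v i))"
  have S: "S \<ge> 0"
    using C(1) by (simp add: S_def sum_nonneg)
  define \<epsilon> where "\<epsilon> = min (\<kappa> / (4 * P)) (W / (8 * (S + 1)))"
  have \<epsilon>: "\<epsilon> > 0" "4 * (P * \<epsilon>) \<le> \<kappa>"
  proof -
    show "\<epsilon> > 0"
      using \<kappa>(1) P(1) W S by (simp add: \<epsilon>_def)
    have "4 * (P * \<epsilon>) \<le> 4 * (P * (\<kappa> / (4 * P)))"
      using P(1) by (intro mult_left_mono) (auto simp: \<epsilon>_def)
    then show "4 * (P * \<epsilon>) \<le> \<kappa>"
      using P(1) by simp
  qed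
  have \<epsilon>S: "2 * (\<epsilon> * S) < W / 4"
  proof -
    have "\<epsilon> * S \<le> W / (8 * (S + 1)) * S"
      using S by (intro mult_right_mono) (auto simp: \<epsilon>_def)
    moreover have "2 * (W / (8 * (S + 1)) * S) < W / 4"
      using W S by (simp add: field_simps)
    ultimately show ?thesis by linarith
  qed
  let ?\<mu> = "density_measure (ball_density I pt v \<epsilon>)"
  have "?\<mu> \<in> W_space p q"
    using \<epsilon>(1) by (intro ball_density_measure_in_W_space p q(1) v_sum) simp
  from H[OF this abs_continuous_density_measure] obtain u0 where
    opt: "optimal_potential F ?\<mu> u0" and null: "\<And>A. transport_set p q u0 A \<Longrightarrow> ?\<mu> A = 0"
    by blast
  have u_lip: "one_lipschitz p q u" and u0_lip: "one_lipschitz p q u0"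
    using F u opt by (auto simp: optimal_potential_def)
  have pt01: "pt 0 = a" "pt 1 = b"
    by (simp_all add: pt_def)
  obtain x y where xy: "x \<in> cball a \<epsilon>" "y \<in> cball b \<epsilon>" "q (u0 y - u0 x) = p (y - x)"
  proof (rule linked_balls[where i = 0 and j = 1 and e = e and v = v and a = pt and I = I, unfolded pt01])
    show "e \<bullet> v 0 \<noteq> 0" "e \<bullet> v 1 = - (e \<bullet> v 0)"
      using e(1) \<delta>(1) ew by (simp_all add: v_def inner_add_right inner_diff_right)
  qed (use p q u0_lip \<epsilon>(1) null ew in \<open>auto simp: I_def v_def\<close>)
  have near: "p (x - a) \<le> P * \<epsilon>" "p (y - b) \<le> P * \<epsilon>"
    using xy(1,2) P(1) by (auto simp: dist_norm norm_minus_commute intro!: order_trans[OF P(2)] mult_left_mono)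
  have "D - \<kappa> \<le> q (u0 b - u0 a)"
    using isometric_pair_nearby[OF p q(1) u0_lip xy(3) near] \<epsilon>(2) unfolding D_def by linarith
  moreover have "q (u0 c - u0 a) \<le> t * D" "q (u0 b - u0 c) \<le> (1 - t) * D"
    using u0_lip[unfolded one_lipschitz_def, rule_format, of c a]
      u0_lip[unfolded one_lipschitz_def, rule_format, of b c] t
    by (simp_all add: ca bc is_norm_scaleR[OF p] D_def)
  ultimately have "norm (((1 - t) * D) *\<^sub>R (u0 c - u0 a) - (t * D) *\<^sub>R (u0 b - u0 c)) < D * norm w / 4"
    by (intro \<kappa>(2)) (simp_all add: algebra_simps)
  also have "((1 - t) * D) *\<^sub>R (u0 c - u0 a) - (t * D) *\<^sub>R (u0 b - u0 c) = D *\<^sub>R defect u0"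
    by (simp add: defect_def algebra_simps)
  finally have "norm (defect u0) < norm w / 4"
    using D by simp
  then have "norm w * norm (defect u0) \<le> norm w * (norm w / 4)"
    by (intro mult_left_mono) auto
  then have small: "w \<bullet> defect u0 \<le> W / 4"
    using norm_cauchy_schwarz[of w "defect u0"] by (simp add: W_def dot_square_norm power2_eq_square)
  let ?\<beta> = "measure lborel (cball (0 :: real ^ 'n) \<epsilon>)"
  have "?\<beta> > 0"
    using \<epsilon>(1) by simp
  have approx: "\<bar>vector_integral f ?\<mu> - ?\<beta> * (w \<bullet> defect f + \<delta> * (e \<bullet> (f a - f b)))\<bar> \<le> ?\<beta> * (\<epsilon> * S)"
    if "one_lipschitz p q f" for f
    using vector_integral_ball_density[where u = f and C = C and \<epsilon> = \<epsilon> and I = I and a = pt and v = v] C that \<epsilon>(1)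
    unfolding pairing by (simp add: S_def ac_simps)
  have "vector_integral u ?\<mu> \<le> vector_integral u0 ?\<mu>"
    by (rule optimal_potential_ge[OF opt u])
  then have "?\<beta> * (w \<bullet> defect u + \<delta> * (e \<bullet> (u a - u b))) - ?\<beta> * (\<epsilon> * S) \<le>
      ?\<beta> * (w \<bullet> defect u0 + \<delta> * (e \<bullet> (u0 a - u0 b))) + ?\<beta> * (\<epsilon> * S)"
    using approx[OF u_lip] approx[OF u0_lip] by linarith
  then have "?\<beta> * (w \<bullet> defect u + \<delta> * (e \<bullet> (u a - u b)) - \<epsilon> * S) \<le>
      ?\<beta> * (w \<bullet> defect u0 + \<delta> * (e \<bullet> (u0 a - u0 b)) + \<epsilon> * S)"
    by (simp add: algebra_simps)
  then have "w \<bullet> defect u + \<delta> * (e \<bullet> (u a - u b)) - \<epsilon> * S \<le>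
      w \<bullet> defect u0 + \<delta> * (e \<bullet> (u0 a - u0 b)) + \<epsilon> * S"
    using \<open>?\<beta> > 0\<close> by simp
  then show False
    using shift[OF u_lip] shift[OF u0_lip] small \<epsilon>S \<delta>(2) W unfolding w_def[symmetric] W_def[symmetric]
    by linarith
qed

section \<open>Some potential is an isometry\<close>

text \<open>Dividing a positive integrable function by \<open>1 + norm x\<close> makes the first moment finite.\<close>

lemma positive_density_with_first_moment:
  obtains G :: "'a::euclidean_space \<Rightarrow> real"
  where "\<And>x. 0 < G x" "integrable lborel G" "integrable lborel (\<lambda>x. norm x * G x)"
proof -
  obtain h :: "'a \<Rightarrow> ennreal" where h: "h \<in> borel_measurable lborel" "integral\<^sup>N lborel h \<noteq> \<infinity>"
    "\<And>x. 0 < h x" "\<And>x. h x < \<infinity>"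
    using sigma_finite_measure.Ex_finite_integrable_function[OF sigma_finite_lborel] by auto
  then have [measurable]: "h \<in> borel_measurable borel"
    by simp
  let ?g = "\<lambda>x. enn2real (h x)"
  have g: "integrable lborel ?g"
  proof (rule integrableI_nonneg)
    have "(\<integral>\<^sup>+x. ennreal (?g x) \<partial>lborel) = integral\<^sup>N lborel h"
      using h(4) by (intro nn_integral_cong) (simp add: less_top)
    then show "(\<integral>\<^sup>+x. ennreal (?g x) \<partial>lborel) < \<infinity>"
      using h(2) by (simp add: less_top)
  qed auto
  define G where "G x = ?g x / (1 + norm x)" for x
  have [measurable]: "G \<in> borel_measurable borel"
    unfolding G_def by measurable
  have pos: "0 < 1 + norm x" for x :: 'a
    using norm_ge_zero[of x] by linarith
  have G_pos: "0 < G x" for x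
    using h(3,4)[of x] pos[of x] by (simp add: G_def enn2real_positive_iff)
  have le: "\<bar>G x\<bar> \<le> \<bar>?g x\<bar>" "\<bar>norm x * G x\<bar> \<le> \<bar>?g x\<bar>" for x
  proof -
    have "(1 + norm x) * G x = ?g x"
      using pos[of x] by (simp add: G_def)
    then have "?g x = G x + norm x * G x"
      by (simp add: distrib_right)
    then show "\<bar>G x\<bar> \<le> \<bar>?g x\<bar>" "\<bar>norm x * G x\<bar> \<le> \<bar>?g x\<bar>"
      using G_pos[of x] by (simp_all add: abs_mult)
  qed
  show ?thesis
  proof (rule that[OF G_pos])
    show "integrable lborel G" "integrable lborel (\<lambda>x. norm x * G x)"
      using le by (auto intro!: Bochner_Integration.integrable_bound[OF g])
  qed
qed

lemma balanced_density_around_ball: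
  obtains \<phi> :: "'a::euclidean_space \<Rightarrow> real"
  where "integrable lborel \<phi>" "integrable lborel (\<lambda>x. norm x * \<phi> x)" "integral\<^sup>L lborel \<phi> = 0"
    "\<And>x. x \<notin> cball 0 1 \<Longrightarrow> \<phi> x < 0"
proof -
  obtain G :: "'a \<Rightarrow> real" where G: "\<And>x. 0 < G x" "integrable lborel G"
    "integrable lborel (\<lambda>x. norm x * G x)"
    by (rule positive_density_with_first_moment) blast
  let ?B = "cball (0 :: 'a) 1"
  \<comment> \<open>The constant that balances the mass outside the ball.\<close>
  let ?c = "(LINT x|lborel. indicat_real (- ?B) x * G x) / measure lborel ?B"
  define \<phi> where "\<phi> x = indicat_real ?B x * ?c - indicat_real (- ?B) x * G x" for x
  have inside: "integrable lborel (\<lambda>x. indicat_real ?B x * g x)" if "continuous_on ?B g"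
    for g :: "'a \<Rightarrow> real"
    using borel_integrable_compact[of ?B g] that by simp
  have outside: "integrable lborel (\<lambda>x. indicat_real (- ?B) x * g x)" if "integrable lborel g"
    for g :: "'a \<Rightarrow> real"
    using integrable_mult_indicator[of "- ?B" lborel g] that by simp
  show ?thesis
  proof (rule that)
    show "integrable lborel \<phi>"
      unfolding \<phi>_def by (intro Bochner_Integration.integrable_diff inside outside G(2) continuous_intros)
    have "integrable lborel (\<lambda>x. indicat_real ?B x * (norm x * ?c) - indicat_real (- ?B) x * (norm x * G x))"
      by (intro Bochner_Integration.integrable_diff inside outside G(3) continuous_intros)
    then show "integrable lborel (\<lambda>x. norm x * \<phi> x)"
      by (simp add: \<phi>_def algebra_simps)
    have "integral\<^sup>L lborel \<phi> = (LINT x|lborel. indicat_real ?B x * ?c) - (LINT x|lborel. indicat_real (- ?B) x * G x)"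
      unfolding \<phi>_def
      by (intro Bochner_Integration.integral_diff inside outside G(2) continuous_intros)
    also have "(LINT x|lborel. indicat_real ?B x * ?c) = measure lborel ?B * ?c"
      by simp
    also have "\<dots> - (LINT x|lborel. indicat_real (- ?B) x * G x) = 0"
      using content_cball_gt_0_iff[of "0 :: 'a" 1] by simp
    finally show "integral\<^sup>L lborel \<phi> = 0" .
    show "\<phi> x < 0" if "x \<notin> ?B" for x
      using that G(1)[of x] by (simp add: \<phi>_def)
  qed
qed

text \<open>Every point \<open>s *\<^sub>R w\<close> is linked to a point of the unit ball, so \<open>s (p w - q (L w))\<close> is bounded
  in \<open>s\<close>.\<close>

lemma linear_isometry_if_saturated_ball:
  fixes p :: "'a::euclidean_space \<Rightarrow> real" and q :: "'b::euclidean_space \<Rightarrow> real"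
  assumes p: "is_norm p" and q: "is_norm q" and L: "linear L" and lip: "one_lipschitz p q L"
    and sat: "saturation p q L (cball 0 1) = UNIV"
  shows "q (L w) = p w"
proof (rule ccontr)
  assume neq: "q (L w) \<noteq> p w"
  have le: "q (L z) \<le> p z" for z
    using lip[unfolded one_lipschitz_def, rule_format, of z 0] by (simp add: linear_0[OF L])
  with neq have gap: "0 < p w - q (L w)"
    using le[of w] by linarith
  obtain P where P: "P > 0" "\<And>x. p x \<le> P * norm x"
    using is_norm_upper_bound[OF p] by metis
  \<comment> \<open>The bound on \<open>s (p w - q (L w))\<close> obtained below is \<open>2 * P\<close>.\<close>
  define s where "s = (2 * P + 1) / (p w - q (L w))"
  have s: "s > 0"
    using gap P(1) by (simp add: s_def)
  have "s *\<^sub>R w \<in> saturation p q L (cball 0 1)"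
    using sat by simp
  then obtain x where x: "x \<in> cball 0 1" "q (L (s *\<^sub>R w) - L x) = p (s *\<^sub>R w - x)"
    unfolding saturation_def by blast
  have px: "p x \<le> P"
    using x(1) P(1) mult_left_mono[of "norm x" 1 P] by (intro order_trans[OF P(2)]) simp
  have "p (s *\<^sub>R w) \<le> p (s *\<^sub>R w - x) + p x"
    using is_norm_triangle[OF p, of "s *\<^sub>R w - x" x] by simp
  also have "p (s *\<^sub>R w - x) \<le> q (L (s *\<^sub>R w)) + q (L x)"
    using is_norm_triangle[OF q, of "L (s *\<^sub>R w)" "- L x"] x(2) by (simp add: is_norm_minus[OF q])
  finally have "s * (p w - q (L w)) \<le> 2 * P"
    using px le[of x] s
    by (simp add: linear_scale[OF L] is_norm_scaleR[OF p] is_norm_scaleR[OF q] algebra_simps)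
  moreover have "s * (p w - q (L w)) = 2 * P + 1"
    using gap by (simp add: s_def)
  ultimately show False by simp
qed

text \<open>The saturation contains the ball, hence all the positive mass. It balances only if it misses no
  more than a null set, and being closed it then misses nothing.\<close>

lemma saturated_ball_if_transport_sets_null:
  fixes p :: "'a::euclidean_space \<Rightarrow> real" and q :: "'b::euclidean_space \<Rightarrow> real"
    and v :: "'c::euclidean_space"
  assumes p: "is_norm p" and q: "is_norm q" and u: "one_lipschitz p q u"
    and \<phi>: "integrable lborel \<phi>" "integral\<^sup>L lborel \<phi> = 0" "\<And>x. x \<notin> cball 0 1 \<Longrightarrow> \<phi> x < 0"
    and v: "v \<noteq> 0"
    and null: "\<And>A. transport_set p q u A \<Longrightarrow> density_measure (\<lambda>x. \<phi> x *\<^sub>R v) A = 0"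
  shows "saturation p q u (cball 0 1) = UNIV"
proof -
  let ?A = "saturation p q u (cball 0 1)"
  have closed: "closed ?A"
    by (intro closed_saturation p q u compact_cball)
  have ball: "cball 0 1 \<subseteq> ?A"
    by (rule subset_saturation[OF p q])
  have int: "integrable lborel (\<lambda>x. indicat_real S x * \<phi> x)" if "S \<in> sets borel" for S
    using integrable_mult_indicator[of S lborel \<phi>] that \<phi>(1) by simp
  have A: "?A \<in> sets borel"
    using closed by auto
  have "0 = density_measure (\<lambda>x. \<phi> x *\<^sub>R v) ?A"
    by (intro null[symmetric] transport_set_saturation p q u compact_cball)
  also have "\<dots> = (LINT x|lborel. indicat_real ?A x * \<phi> x) *\<^sub>R v"
    unfolding density_measure_def set_lebesgue_integral_def using int[OF A] by simp
  finally have "(LINT x|lborel. indicat_real ?A x * \<phi> x) = 0"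
    using v by simp
  then have "0 = (LINT x|lborel. \<phi> x) - (LINT x|lborel. indicat_real ?A x * \<phi> x)"
    using \<phi>(2) by simp
  also have "\<dots> = (LINT x|lborel. \<phi> x - indicat_real ?A x * \<phi> x)"
    using \<phi>(1) int[OF A] by simp
  also have "\<dots> = - (LINT x|lborel. indicat_real (- ?A) x * (- \<phi> x))"
    by (subst Bochner_Integration.integral_minus[symmetric], intro Bochner_Integration.integral_cong)
      (auto split: split_indicator)
  finally have "(LINT x|lborel. indicat_real (- ?A) x * (- \<phi> x)) = 0"
    by simp
  moreover have "integrable lborel (\<lambda>x. indicat_real (- ?A) x * (- \<phi> x))"
    using int[of "- ?A"] A by simp
  moreover have nonneg: "0 \<le> indicat_real (- ?A) x * (- \<phi> x)" for x
  proof (cases "x \<in> ?A")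
    case False
    then have "\<phi> x < 0"
      using ball by (intro \<phi>(3)) blast
    with False show ?thesis by simp
  qed simp
  ultimately have "AE x in lborel. indicat_real (- ?A) x * (- \<phi> x) = 0"
    using integral_nonneg_eq_0_iff_AE[of lborel "\<lambda>x. indicat_real (- ?A) x * (- \<phi> x)"] by simp
  then have "AE x in lborel. x \<in> ?A"
  proof (rule eventually_mono)
    fix x assume "indicat_real (- ?A) x * (- \<phi> x) = 0"
    then show "x \<in> ?A"
      using subsetD[OF ball, of x] \<phi>(3)[of x] by (cases "x \<in> ?A") fastforce+
  qed
  then have "AE x in lebesgue. x \<in> ?A"
    by (rule AE_completion)
  from mem_closed_if_AE_lebesgue[OF closed this] show ?thesis
    by auto
qed

lemma isometry_if_transport_sets_null:
  fixes p :: "real ^ 'n \<Rightarrow> real" and q :: "real ^ 'm \<Rightarrow> real"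
    and F :: "(real ^ 'n \<Rightarrow> real ^ 'm) set"
  assumes p: "is_norm p" and q: "is_norm q"
    and F: "\<And>u. u \<in> F \<Longrightarrow> one_lipschitz p q u" "\<And>u. u \<in> F \<Longrightarrow> affine_map u"
    and H: "\<And>\<mu>. \<mu> \<in> W_space p q \<Longrightarrow> abs_continuous \<mu> \<Longrightarrow>
      \<exists>u0. optimal_potential F \<mu> u0 \<and> (\<forall>A. transport_set p q u0 A \<longrightarrow> \<mu> A = 0)"
  shows "\<exists>u\<in>F. \<exists>L b. linear L \<and> u = (\<lambda>x. L x + b) \<and> (\<forall>w. q (L w) = p w)"
proof -
  obtain \<phi> :: "real ^ 'n \<Rightarrow> real" where \<phi>: "integrable lborel \<phi>"
    "integrable lborel (\<lambda>x. norm x * \<phi> x)" "integral\<^sup>L lborel \<phi> = 0"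
    "\<And>x. x \<notin> cball 0 1 \<Longrightarrow> \<phi> x < 0"
    by (rule balanced_density_around_ball) blast
  obtain v :: "real ^ 'm" where v: "v \<noteq> 0"
    using nonzero_Basis nonempty_Basis by blast
  let ?\<mu> = "density_measure (\<lambda>x. \<phi> x *\<^sub>R v)"
  have "?\<mu> \<in> W_space p q"
  proof (rule density_measure_in_W_space[OF p q])
    have "integrable lborel (\<lambda>x. norm (norm x * \<phi> x) * norm v)"
      using \<phi>(2) by (intro integrable_mult_left integrable_norm)
    then show "integrable lborel (\<lambda>x. norm x * norm (\<phi> x *\<^sub>R v))"
      by (simp add: abs_mult mult.assoc)
  qed (use \<phi> in simp_all)
  from H[OF this abs_continuous_density_measure] obtain u where
    u: "u \<in> F" and null: "\<And>A. transport_set p q u A \<Longrightarrow> ?\<mu> A = 0"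
    unfolding optimal_potential_def by blast
  obtain L b where L: "linear L" and ueq: "u = (\<lambda>x. L x + b)"
    using F(2)[OF u] unfolding affine_map_def by blast
  have "saturation p q u (cball 0 1) = UNIV"
    using saturated_ball_if_transport_sets_null[OF p q F(1)[OF u] \<phi>(1,3,4) v null] .
  then have sat: "saturation p q L (cball 0 1) = UNIV"
    by (simp add: saturation_def ueq)
  have "one_lipschitz p q L"
    using F(1)[OF u] by (simp add: one_lipschitz_def ueq)
  from linear_isometry_if_saturated_ball[OF p q L this sat] show ?thesis
    using u L ueq by blast
qed

section \<open>The characterization\<close>

lemma linear_isometry_surj:
  fixes L :: "real ^ 'n \<Rightarrow> real ^ 'm"
  assumes p: "is_norm p" and L: "linear L" "\<forall>w. q (L w) = p w"
    and q: "is_norm q" and mn: "CARD('m) \<le> CARD('n)"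
  shows "CARD('m) = CARD('n) \<and> surj L"
proof -
  have "w = 0" if "L w = 0" for w
    using spec[OF L(2), of w] that is_norm_0[OF q] is_norm_eq_0D[OF p, of w] by simp
  then have inj: "inj L"
    using linear_injective_0[OF L(1)] by blast
  have "dim (range L) = dim (UNIV :: (real ^ 'n) set)"
    by (rule dim_image_eq[OF L(1)]) (use inj in auto)
  then have "CARD('n) \<le> CARD('m)"
    using dim_subset_UNIV[of "range L"] by simp
  with mn have "CARD('m) = CARD('n)"
    by simp
  moreover from this have "surj L"
    using linear_injective_imp_surjective[OF L(1) inj] by simp
  ultimately show ?thesis ..
qed

theorem theorem6:
  fixes p :: "real ^ 'n \<Rightarrow> real" and q :: "real ^ 'm \<Rightarrow> real"
    and F :: "(real ^ 'n \<Rightarrow> real ^ 'm) set"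
  assumes "CARD('m) \<le> CARD('n)"
    and "is_norm p" and "is_norm q" and "strictly_convex_norm q"
    and "\<forall>u\<in>F. one_lipschitz p q u"
    and "locally_uniformly_closed F"
  shows
    "((\<forall>\<mu>\<in>W_space p q. abs_continuous \<mu> \<longrightarrow> (\<exists>u0. optimal_potential F \<mu> u0)) \<longrightarrow>
      (\<forall>\<mu>\<in>W_space p q. abs_continuous \<mu> \<longrightarrow>
        (\<forall>u0. optimal_potential F \<mu> u0 \<longrightarrow> (\<forall>A. transport_set p q u0 A \<longrightarrow> \<mu> A = 0))) \<longrightarrow>
      CARD('m) = 1 \<or>
      (CARD('m) > 1 \<and>
       (CARD('m) = CARD('n) \<and> (\<forall>u\<in>F. affine_map u) \<and>
        (\<exists>u\<in>F. isometric_on p q u UNIV \<and> surj u)) \<and>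
       (\<forall>\<mu>\<in>W_space p q. abs_continuous \<mu> \<longrightarrow>
         (\<forall>u. optimal_potential F \<mu> u \<longrightarrow>
           (\<exists>V. maximal_isometry_subspace p q u V \<and> vanishes_on_cylinders \<mu> V)))))
     \<and>
     (euclidean_norm p \<and> euclidean_norm q \<longrightarrow>
      (\<forall>\<mu>\<in>W_space p q. abs_continuous \<mu> \<longrightarrow>
        (\<forall>u. optimal_potential F \<mu> u \<longrightarrow>
          affine_map u \<and>
          (\<exists>V. maximal_isometry_subspace p q u V \<and> vanishes_on_cylinders \<mu> V)) \<longrightarrow>
        (\<forall>u. optimal_potential F \<mu> u \<longrightarrow> (\<forall>A. transport_set p q u A \<longrightarrow> \<mu> A = 0))))"
proof (intro conjI impI)
  note p = assms(2) and q = assms(3)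
  have F: "\<And>u. u \<in> F \<Longrightarrow> one_lipschitz p q u"
    using assms(5) by blast
  assume ex: "\<forall>\<mu>\<in>W_space p q. abs_continuous \<mu> \<longrightarrow> (\<exists>u0. optimal_potential F \<mu> u0)"
    and null: "\<forall>\<mu>\<in>W_space p q. abs_continuous \<mu> \<longrightarrow>
      (\<forall>u0. optimal_potential F \<mu> u0 \<longrightarrow> (\<forall>A. transport_set p q u0 A \<longrightarrow> \<mu> A = 0))"
  have H: "\<exists>u0. optimal_potential F \<mu> u0 \<and> (\<forall>A. transport_set p q u0 A \<longrightarrow> \<mu> A = 0)"
    if "\<mu> \<in> W_space p q" "abs_continuous \<mu>" for \<mu>
    using ex null that by metis
  show "CARD('m) = 1 \<or>
      (CARD('m) > 1 \<and>
       (CARD('m) = CARD('n) \<and> (\<forall>u\<in>F. affine_map u) \<and>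
        (\<exists>u\<in>F. isometric_on p q u UNIV \<and> surj u)) \<and>
       (\<forall>\<mu>\<in>W_space p q. abs_continuous \<mu> \<longrightarrow>
         (\<forall>u. optimal_potential F \<mu> u \<longrightarrow>
           (\<exists>V. maximal_isometry_subspace p q u V \<and> vanishes_on_cylinders \<mu> V))))"
  proof (cases "CARD('m) = 1")
    case False
    moreover have "CARD('m) > 0"
      by simp
    ultimately have m: "CARD('m) > 1"
      by linarith
    have affine: "affine_map u" if "u \<in> F" for u
      by (rule affine_if_transport_sets_null[OF m p q assms(4) F H that])
    obtain u L b where u: "u \<in> F" "linear L" "u = (\<lambda>x. L x + b)" "\<forall>w. q (L w) = p w"
      using isometry_if_transport_sets_null[OF p q F affine H] by blast
    have card: "CARD('m) = CARD('n)" and surj: "surj L"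
      using linear_isometry_surj[OF p u(2,4) q assms(1)] by auto
    have "isometric_on p q u UNIV"
      unfolding isometric_on_def u(3) using u(4) linear_diff[OF u(2)] by (metis add_diff_cancel_right)
    moreover have "surj u"
    proof (rule surjI)
      show "u (inv L (y - b)) = y" for y
        by (simp add: u(3) surj_f_inv_f[OF surj])
    qed
    moreover have "\<exists>V. maximal_isometry_subspace p q u V \<and> vanishes_on_cylinders \<mu> V"
      if "\<mu> \<in> W_space p q" "abs_continuous \<mu>" "optimal_potential F \<mu> u" for \<mu> u
    proof -
      have "u \<in> F"
        using that(3) by (simp add: optimal_potential_def)
      from affine[OF this] obtain L b where L: "linear L" "u = (\<lambda>x. L x + b)"
        unfolding affine_map_def by blast
      show ?thesis
        using null that by (intro vanishes_on_maximal_isometry_subspace[OF p q L]) blast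
    qed
    ultimately show ?thesis
      using m card affine u(1) by blast
  qed simp
next
  assume "euclidean_norm p \<and> euclidean_norm q"
  then have e: "euclidean_norm p" "euclidean_norm q"
    by simp_all
  show "\<forall>\<mu>\<in>W_space p q. abs_continuous \<mu> \<longrightarrow>
        (\<forall>u. optimal_potential F \<mu> u \<longrightarrow>
          affine_map u \<and>
          (\<exists>V. maximal_isometry_subspace p q u V \<and> vanishes_on_cylinders \<mu> V)) \<longrightarrow>
        (\<forall>u. optimal_potential F \<mu> u \<longrightarrow> (\<forall>A. transport_set p q u A \<longrightarrow> \<mu> A = 0))"
  proof (intro ballI impI allI)
    fix \<mu> :: "(real ^ 'n) set \<Rightarrow> real ^ 'm" and u A
    assume "\<forall>u. optimal_potential F \<mu> u \<longrightarrow> affine_map u \<and>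
        (\<exists>V. maximal_isometry_subspace p q u V \<and> vanishes_on_cylinders \<mu> V)"
      and opt: "optimal_potential F \<mu> u" and A: "transport_set p q u A"
    then obtain V where affine: "affine_map u"
      and V: "maximal_isometry_subspace p q u V" "vanishes_on_cylinders \<mu> V"
      by blast
    have "one_lipschitz p q u"
      using opt assms(5) by (simp add: optimal_potential_def)
    from transport_set_null_of_vanishes_on_cylinders[OF assms(2) e(1) assms(3) e(2) this affine V A]
    show "\<mu> A = 0" .
  qed
qed

end
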